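(* Let $G=(V,E,\omega,m)$ be a finite connected weighted graph, $n$ a positive integer, $f_1,\dots,f_n:V\to\mathbb{R}$ with $f_n$ not identically zero, and suppose that at least one $f_i$, $1\leqslant i\leqslant n$, is positive somewhere. For $c\in\mathbb{R}$ consider the equation $$-\Delta u(x)=\sum_{i=1}^n f_i(x)e^{iu(x)}+c,\qquad x\in V. \qquad (\ast)$$ Distinguish the cases: (A) $q(F_n)=+\infty$, with either $c>0$, or $c=0$ and $\overline{f_1}\geqslant0$; (B) $q(F_n)<+\infty$, with either $c<0$, or $c=0$ and $\overline{f_1}\leqslant0$. There exist a positive constant $c_n$ depending on $f_1,\dots,f_n$ (and $G$), and for each $2\leqslant i\leqslant n$ a function $f_i^*:V\to\mathbb{R}$ depending on the other functions $f_j$, $1\leqslant j\leqslant n$, $j\neq i$ (and $G$), such that $(\ast)$ is solvable if one of the following conditions holds: (i* ) $\overline{f_1}<0$ in case (A) and $c\in(0,c_n]$; (ii* ) $\overline{f_1}>0$ in case (B) and $c\in[-c_n,0)$; (iii* ) $\overline{f_1}\geqslant0$ in case (A), $f_i\leqslant f_i^*$ on $V$ for some integer $2\leqslant i\leqslant n$, and $c\in[0,c_n]$; (iv* ) $\overline{f_1}\leqslant0$ in case (B), $f_i\geqslant f_i^*$ on $V$ for some integer $2\leqslant i\leqslant n-1$, and $c\in[-c_n,0]$. Further, if one of the conditions (i* ), (ii* ), (iii* ), (iv* ) holds, then $(\ast)$ admits at least two solutions if $c\in(0,c_n)$ in case (A) or $c\in(-c_n,0)$ in case (B).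
   Context: A finite connected weighted graph $G=(V,E,\omega,m)$ consists of a finite connected graph $(V,E)$, a positive vertex weight $m:V\to(0,\infty)$, and a symmetric edge weight $\omega:V\times V\to[0,\infty)$, $\omega_{xy}=\omega_{yx}$, with $\omega_{xy}>0$ if and only if $\{x,y\}\in E$ (written $x\sim y$). The graph Laplacian is $\Delta u(x)=\frac{1}{m(x)}\sum_{y\sim x}\omega_{xy}(u(y)-u(x))$. The average of $f:V\to\mathbb{R}$ is $\overline f=\frac{\sum_{x\in V}m(x)f(x)}{\sum_{x\in V}m(x)}$. Put $F_n(x,y)=\sum_{i=1}^n f_i(x)e^{iy}+c$ for $x\in V$, $y\in\mathbb{R}$, and $q(F_n)=\max_{x\in V}\lim_{y\to+\infty}F_n(x,y)\in[-\infty,+\infty]$; whether $q(F_n)$ is finite or $+\infty$ does not depend on $c$. A solution is a function $u:V\to\mathbb{R}$ satisfying the equation at every vertex. *)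

theory Defs
  imports "HOL-Analysis.Analysis"
begin

text \<open>The vertex set is the whole (nonempty, finite) type \<open>'v\<close>; edges are unordered pairs.
  Loops \<open>{x}\<close> are permitted, since they do not contribute to the Laplacian.\<close>

locale finite_connected_weighted_graph =
  fixes E :: "'v::finite set set" and \<omega> :: "'v \<Rightarrow> 'v \<Rightarrow> real" and m :: "'v \<Rightarrow> real"
  assumes edges: "e \<in> E \<Longrightarrow> \<exists>x y. e = {x, y}"
    and connected: "(x, y) \<in> {(a, b). {a, b} \<in> E}\<^sup>*"
    and vertex_weight_pos: "m x > 0"
    and edge_weight_nonneg: "\<omega> x y \<ge> 0"
    and edge_weight_sym: "\<omega> x y = \<omega> y x"
    and edge_weight_pos_iff: "\<omega> x y > 0 \<longleftrightarrow> {x, y} \<in> E"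

definition laplacian ::
  "'v::finite set set \<Rightarrow> ('v \<Rightarrow> 'v \<Rightarrow> real) \<Rightarrow> ('v \<Rightarrow> real) \<Rightarrow> ('v \<Rightarrow> real) \<Rightarrow> 'v \<Rightarrow> real" where
  "laplacian E \<omega> m u x = (1 / m x) * (\<Sum>y | {x, y} \<in> E. \<omega> x y * (u y - u x))"

definition average :: "('v::finite \<Rightarrow> real) \<Rightarrow> ('v \<Rightarrow> real) \<Rightarrow> real" where
  "average m f = (\<Sum>x\<in>UNIV. m x * f x) / (\<Sum>x\<in>UNIV. m x)"

text \<open>Tuples \<open>f\<^sub>1, \<dots>, f\<^sub>n\<close> are functions on \<open>nat\<close> of which only the values at \<open>1, \<dots>, n\<close> are used.\<close>

definition F :: "nat \<Rightarrow> (nat \<Rightarrow> 'v \<Rightarrow> real) \<Rightarrow> real \<Rightarrow> 'v \<Rightarrow> real \<Rightarrow> real" where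
  "F n f c x y = (\<Sum>i=1..n. f i x * exp (real i * y)) + c"

text \<open>For each \<open>x\<close>, \<open>F n f c x y\<close> is a polynomial in \<open>exp y\<close>, so the limit below
  always exists in the extended reals.\<close>

definition q :: "nat \<Rightarrow> (nat \<Rightarrow> 'v::finite \<Rightarrow> real) \<Rightarrow> real \<Rightarrow> ereal" where
  "q n f c = (MAX x\<in>UNIV. Lim at_top (\<lambda>y. ereal (F n f c x y)))"

definition case_A :: "('v::finite \<Rightarrow> real) \<Rightarrow> nat \<Rightarrow> (nat \<Rightarrow> 'v \<Rightarrow> real) \<Rightarrow> real \<Rightarrow> bool" where
  "case_A m n f c \<longleftrightarrow> q n f c = \<infinity> \<and> (c > 0 \<or> c = 0 \<and> average m (f 1) \<ge> 0)"

definition case_B :: "('v::finite \<Rightarrow> real) \<Rightarrow> nat \<Rightarrow> (nat \<Rightarrow> 'v \<Rightarrow> real) \<Rightarrow> real \<Rightarrow> bool" where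
  "case_B m n f c \<longleftrightarrow> q n f c < \<infinity> \<and> (c < 0 \<or> c = 0 \<and> average m (f 1) \<le> 0)"

definition is_solution ::
  "'v::finite set set \<Rightarrow> ('v \<Rightarrow> 'v \<Rightarrow> real) \<Rightarrow> ('v \<Rightarrow> real) \<Rightarrow> nat \<Rightarrow> (nat \<Rightarrow> 'v \<Rightarrow> real) \<Rightarrow> real
    \<Rightarrow> ('v \<Rightarrow> real) \<Rightarrow> bool" where
  "is_solution E \<omega> m n f c u \<longleftrightarrow>
    (\<forall>x. - laplacian E \<omega> m u x = (\<Sum>i=1..n. f i x * exp (real i * u x)) + c)"

text \<open>The tuple \<open>(f\<^sub>j)\<close> with \<open>1 \<le> j \<le> n\<close> and \<open>j \<noteq> i\<close>: all other entries, in particular \<open>f\<^sub>i\<close>,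
  are erased, so a function of \<open>others n i f\<close> cannot depend on \<open>f\<^sub>i\<close>.\<close>

definition others :: "nat \<Rightarrow> nat \<Rightarrow> (nat \<Rightarrow> 'v \<Rightarrow> real) \<Rightarrow> nat \<Rightarrow> 'v \<Rightarrow> real" where
  "others n i f = restrict f ({1..n} - {i})"

end

theory Submission
  imports Defs
begin

text \<open>Where some leading coefficient is positive (\<open>q = \<infinity>\<close>), a strict supersolution \<open>\<psi>\<close> for \<open>c = 0\<close>
  remains one for all small \<open>c > 0\<close>, and very negative constants are strict subsolutions, so there is
  a solution in the order box below \<open>\<psi>\<close>. Solutions are bounded uniformly for \<open>c\<close> in compact subsets
  of \<open>(0, \<infinity>)\<close> and there are none for large \<open>c\<close>, so the degree on a large ball is 0, whereas
  it is 1 on the box: there is a second solution outside the box. The degree argument is carried out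
  by hand with Brouwer's theorem. As \<open>c\<close> tends to 0 these second solutions, not lying below \<open>\<psi>\<close>,
  stay bounded, and a limit solves the equation for \<open>c = 0\<close>. If \<open>q < \<infinity>\<close>, the same argument works with a
  strict subsolution \<open>\<phi>\<close> as the lower side of the box and a large constant as its upper side,
  letting \<open>c\<close> tend to \<open>-\<infinity>\<close>; for \<open>c = 0\<close> the box itself contains a solution.

  If the average of \<open>f\<^sub>1\<close> is nonzero, \<open>\<psi>\<close> or \<open>\<phi>\<close> is found near \<open>-\<infinity>\<close>; otherwise it is supplied by
  the threshold for \<open>f\<^sub>i\<close>.\<close>

section \<open>Zeros of continuous maps inside and outside a box\<close>

text \<open>The Poincare-Miranda theorem. Brouwer's theorem gives a fixed point of
  \<open>u - G u\<close> clamped to the box. A nonzero component of \<open>G\<close> there would put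
  \<open>u\<close> on the face where its sign is excluded.\<close>

lemma box_zero_exists:
  fixes G :: "real^'v \<Rightarrow> real^'v"
  assumes ab: "\<And>x. a $ x \<le> b $ x" and cont: "continuous_on (cbox a b) G"
    and upper: "\<And>u x. u \<in> cbox a b \<Longrightarrow> u $ x = b $ x \<Longrightarrow> G u $ x \<ge> 0"
    and lower: "\<And>u x. u \<in> cbox a b \<Longrightarrow> u $ x = a $ x \<Longrightarrow> G u $ x \<le> 0"
  shows "\<exists>u\<in>cbox a b. G u = 0"
proof -
  define T where "T u = (\<chi> x. max (a $ x) (min (b $ x) (u $ x - G u $ x)))" for u
  have "\<exists>u\<in>cbox a b. T u = u"
  proof (rule brouwer)
    show "cbox a b \<noteq> {}"
      using ab by (auto simp: cbox_def Basis_vec_def inner_axis intro!: exI[of _ a])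
    show "continuous_on (cbox a b) T"
      unfolding T_def by (intro continuous_intros cont)
    show "T \<in> cbox a b \<rightarrow> cbox a b"
      using ab by (auto simp: T_def mem_box_cart)
  qed auto
  then obtain u where u: "u \<in> cbox a b" "T u = u" by blast
  have "G u $ x = 0" for x
  proof -
    have "max (a $ x) (min (b $ x) (u $ x - G u $ x)) = u $ x"
      using arg_cong[OF u(2), of "\<lambda>w. w $ x"] by (simp add: T_def)
    then show ?thesis
      using upper[OF u(1), of x] lower[OF u(1), of x] u(1) ab[of x]
      by (auto simp: mem_box_cart max_def min_def split: if_splits)
  qed
  then have "G u = 0" by (simp add: vec_eq_iff)
  with u(1) show ?thesis by blast
qed

text \<open>If every zero of \<open>G 0\<close> were in the box, the map \<open>\<Psi>\<close> below would have no zero. It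
  agrees with \<open>G 0\<close> on the boundary of the box; moving towards the centre (as the gauge
  \<open>g\<close> decreases from 1 to 0) it first runs through \<open>G 0\<close> on the exterior of the box,
  then deforms \<open>G 0\<close> to \<open>G 1\<close> beyond the a priori bound, and ends with \<open>G 1\<close>.\<close>

lemma zero_outside_box_exists:
  fixes G :: "real \<Rightarrow> real^'v \<Rightarrow> real^'v"
  assumes ab: "\<And>x. a $ x < b $ x"
    and cont: "continuous_on ({0..1} \<times> UNIV) (\<lambda>(s, u). G s u)"
    and upper: "\<And>u x. u \<in> cbox a b \<Longrightarrow> u $ x = b $ x \<Longrightarrow> G 0 u $ x > 0"
    and lower: "\<And>u x. u \<in> cbox a b \<Longrightarrow> u $ x = a $ x \<Longrightarrow> G 0 u $ x < 0"
    and bound: "\<And>s u x. s \<in> {0..1} \<Longrightarrow> G s u = 0 \<Longrightarrow> \<bar>u $ x\<bar> \<le> R"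
    and G1: "\<And>u. G 1 u \<noteq> 0"
  shows "\<exists>u. u \<notin> cbox a b \<and> G 0 u = 0"
proof (rule ccontr)
  assume "\<not> ?thesis"
  then have inside: "\<And>u. u \<notin> cbox a b \<Longrightarrow> G 0 u \<noteq> 0" by blast
  define p w where "p = (1/2) *\<^sub>R (a + b)" and "w = (1/2) *\<^sub>R (b - a)"
  have w: "w $ x > 0" for x using ab[of x] by (simp add: w_def)
  have pw: "a $ x = p $ x - w $ x" "b $ x = p $ x + w $ x" for x
    by (simp_all add: p_def w_def field_simps)
  \<comment> \<open>The weighted maximum norm about the centre \<open>p\<close> whose closed unit
    ball is the box.\<close>
  define g where "g u = infnorm (\<chi> x. (u $ x - p $ x) / w $ x)" for u
  have g_ge: "\<bar>u $ x - p $ x\<bar> \<le> g u * w $ x" for u x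
    using component_le_infnorm_cart[of "\<chi> x. (u $ x - p $ x) / w $ x" x] w[of x]
    by (simp add: g_def field_simps)
  have g_attained: "\<exists>x. \<bar>u $ x - p $ x\<bar> = g u * w $ x" for u
  proof -
    let ?f = "\<lambda>x. \<bar>(u $ x - p $ x) / w $ x\<bar>"
    have "g u = Max (range ?f)"
      by (simp add: g_def infnorm_cart cSup_eq_Max full_SetCompr_eq)
    moreover have "Max (range ?f) \<in> range ?f" by (rule Max_in) auto
    ultimately have "g u \<in> range ?f" by simp
    then obtain x where "g u = ?f x" by blast
    then show ?thesis using w[of x] by (intro exI[of _ x]) (simp add: field_simps)
  qed
  have box_iff: "u \<in> cbox a b \<longleftrightarrow> g u \<le> 1" for u
  proof
    assume u: "u \<in> cbox a b"
    obtain x where x: "\<bar>u $ x - p $ x\<bar> = g u * w $ x" using g_attained by blast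
    have "\<bar>u $ x - p $ x\<bar> \<le> w $ x" using u pw by (auto simp: mem_box_cart abs_le_iff algebra_simps)
    then show "g u \<le> 1" using w[of x] x by simp
  next
    assume "g u \<le> 1"
    then have "g u * w $ x \<le> 1 * w $ x" for x
      using w[of x] by (intro mult_right_mono) auto
    then have "\<bar>u $ x - p $ x\<bar> \<le> w $ x" for x
      using g_ge[of u x] by (metis mult_1 order_trans)
    then show "u \<in> cbox a b"
      unfolding mem_box_cart pw abs_le_iff by (simp add: algebra_simps)
  qed
  \<comment> \<open>A point with gauge at least \<open>\<Lambda> / 8\<close> has a coordinate larger
    than \<open>R\<close> in absolute value, so no \<open>G s\<close> vanishes there. The summand 8
    makes \<open>\<Lambda> * g u > 1\<close> for \<open>g u \<ge> 1/2\<close>.\<close>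
  define \<Lambda> where "\<Lambda> = 8 * (\<Sum>x\<in>UNIV. (\<bar>R\<bar> + \<bar>p $ x\<bar>) / w $ x) + 8"
  have \<Lambda>_ge: "\<bar>R\<bar> + \<bar>p $ x\<bar> < (\<Lambda> / 8) * w $ x" for x
  proof -
    have "(\<bar>R\<bar> + \<bar>p $ x\<bar>) / w $ x \<le> (\<Sum>x\<in>UNIV. (\<bar>R\<bar> + \<bar>p $ x\<bar>) / w $ x)"
      using w by (intro member_le_sum) (auto simp: less_imp_le)
    moreover have "\<Lambda> / 8 = (\<Sum>x\<in>UNIV. (\<bar>R\<bar> + \<bar>p $ x\<bar>) / w $ x) + 1" by (simp add: \<Lambda>_def)
    ultimately have "(\<bar>R\<bar> + \<bar>p $ x\<bar>) / w $ x < \<Lambda> / 8" by linarith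
    then show ?thesis using w[of x] by (simp add: field_simps)
  qed
  have \<Lambda>8: "\<Lambda> \<ge> 8"
    using w by (auto simp: \<Lambda>_def less_imp_le intro!: sum_nonneg)
  \<comment> \<open>The parameter is 0 for \<open>g u \<ge> 1/2\<close> and 1 for
    \<open>g u \<le> 1/4\<close>. The radial map \<open>\<pi>\<close> fixes the boundary, leaves the
    box on the outer shell and passes the a priori bound on the middle shell, the only place where
    the parameter changes.\<close>
  define \<sigma> where "\<sigma> u = max 0 (min 1 (2 - 4 * g u))" for u
  define \<pi> where "\<pi> u = p + (1 + \<Lambda> * (1 - g u)) *\<^sub>R (u - p)" for u
  define \<Psi> where "\<Psi> u = G (\<sigma> u) (\<pi> u)" for u
  have g_scale: "g (\<pi> u) = (1 + \<Lambda> * (1 - g u)) * g u" if "g u \<le> 1" for u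
  proof -
    have "(\<chi> x. (\<pi> u $ x - p $ x) / w $ x) =
        (1 + \<Lambda> * (1 - g u)) *\<^sub>R (\<chi> x. (u $ x - p $ x) / w $ x)"
      by (simp add: \<pi>_def vec_eq_iff)
    then show ?thesis using that \<Lambda>8 unfolding g_def
      by (simp add: infnorm_mul)
  qed
  have nonzero: "\<Psi> u \<noteq> 0" if u: "u \<in> cbox a b" for u
  proof -
    have g1: "g u \<le> 1" using u box_iff by blast
    consider "g u = 1" | "1/2 \<le> g u" "g u < 1" | "1/4 \<le> g u" "g u < 1/2" | "g u < 1/4"
      using g1 by linarith
    then show ?thesis
    proof cases
      case 1
      then have \<Psi>: "\<Psi> u = G 0 u" by (simp add: \<Psi>_def \<sigma>_def \<pi>_def)
      obtain x where "\<bar>u $ x - p $ x\<bar> = w $ x" using g_attained[of u] 1 by auto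
      then have "u $ x = b $ x \<or> u $ x = a $ x" using pw by (auto simp: abs_if split: if_splits)
      then have "G 0 u $ x \<noteq> 0" using upper[OF u, of x] lower[OF u, of x] by auto
      then show ?thesis using \<Psi> by auto
    next
      case 2
      \<comment> \<open>This product equals \<open>g (\<pi> u) - 1\<close>.\<close>
      have "(1 - g u) * (\<Lambda> * g u - 1) > 0"
        using 2 \<Lambda>8 mult_mono[of 8 \<Lambda> "1/2" "g u"] by (intro mult_pos_pos) auto
      then have "g (\<pi> u) > 1" using g_scale[OF g1] by (simp add: algebra_simps)
      then have "\<pi> u \<notin> cbox a b" using box_iff by auto
      moreover have "\<sigma> u = 0" using 2 by (simp add: \<sigma>_def)
      ultimately show ?thesis using inside by (simp add: \<Psi>_def)
    next
      case 3
      have "\<Lambda> * (1/2) \<le> \<Lambda> * (1 - g u)" using 3 \<Lambda>8 by (intro mult_left_mono) auto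
      then have "\<Lambda> / 2 \<le> 1 + \<Lambda> * (1 - g u)" by linarith
      then have "(\<Lambda> / 2) * (1/4) \<le> (1 + \<Lambda> * (1 - g u)) * g u"
        using 3 \<Lambda>8 by (intro mult_mono) auto
      then have g\<pi>: "g (\<pi> u) \<ge> \<Lambda> / 8" using g_scale[OF g1] by simp
      obtain x where x: "\<bar>\<pi> u $ x - p $ x\<bar> = g (\<pi> u) * w $ x" using g_attained by blast
      have "(\<Lambda> / 8) * w $ x \<le> g (\<pi> u) * w $ x" using g\<pi> w[of x] by (intro mult_right_mono) auto
      then have "\<bar>\<pi> u $ x\<bar> > R" using x \<Lambda>_ge[of x] by linarith
      then show ?thesis using bound[of "\<sigma> u" "\<pi> u" x] by (auto simp: \<Psi>_def \<sigma>_def)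
    next
      case 4
      then have "\<sigma> u = 1" by (simp add: \<sigma>_def)
      then show ?thesis using G1 by (simp add: \<Psi>_def)
    qed
  qed
  have bdry: "\<Psi> u = G 0 u" if u: "u \<in> cbox a b" and x: "u $ x = b $ x \<or> u $ x = a $ x" for u x
  proof -
    have "w $ x \<le> g u * w $ x" using g_ge[of u x] x pw[of x] by auto
    then have "g u \<ge> 1" using w[of x] by simp
    then have "g u = 1" using box_iff u by force
    then show ?thesis by (simp add: \<Psi>_def \<sigma>_def \<pi>_def)
  qed
  have contg: "continuous_on S g" for S
    unfolding g_def using w by (intro continuous_intros) (metis less_irrefl)
  have "\<exists>u\<in>cbox a b. \<Psi> u = 0"
  proof (rule box_zero_exists)
    have "continuous_on (cbox a b) ((\<lambda>(s, u). G s u) \<circ> (\<lambda>u. (\<sigma> u, \<pi> u)))"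
    proof (rule continuous_on_compose)
      show "continuous_on (cbox a b) (\<lambda>u. (\<sigma> u, \<pi> u))"
        unfolding \<sigma>_def \<pi>_def by (intro continuous_intros contg)
      show "continuous_on ((\<lambda>u. (\<sigma> u, \<pi> u)) ` cbox a b) (\<lambda>(s, u). G s u)"
        by (rule continuous_on_subset[OF cont]) (auto simp: \<sigma>_def)
    qed
    then show "continuous_on (cbox a b) \<Psi>" by (simp add: \<Psi>_def o_def)
    show "a $ x \<le> b $ x" for x using ab[of x] by simp
    show "\<Psi> u $ x \<ge> 0" if "u \<in> cbox a b" "u $ x = b $ x" for u x
      using bdry[of u x] upper[of u x] that by simp
    show "\<Psi> u $ x \<le> 0" if "u \<in> cbox a b" "u $ x = a $ x" for u x
      using bdry[of u x] lower[of u x] that by simp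
  qed
  then show False using nonzero by blast
qed

section \<open>The nonlinearity\<close>

text \<open>The polynomial in \<open>exp y\<close> at \<open>x\<close> has positive leading
  coefficient; the zero polynomial does not qualify. This is the form in which \<open>q\<close> is
  used.\<close>

definition lead_pos :: "nat \<Rightarrow> (nat \<Rightarrow> 'v \<Rightarrow> real) \<Rightarrow> 'v \<Rightarrow> bool" where
  "lead_pos n f x \<longleftrightarrow> (\<exists>k\<in>{1..n}. f k x > 0 \<and> (\<forall>j\<in>{k<..n}. f j x = 0))"

lemma F_shift: "F n f c x y = F n f 0 x y + c"
  by (simp add: F_def)

lemma is_solution_iff: "is_solution E \<omega> m n f c u \<longleftrightarrow> (\<forall>x. - laplacian E \<omega> m u x = F n f 0 x (u x) + c)"
  by (simp add: is_solution_def F_def)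

text \<open>After division by \<open>exp (k * y)\<close> the terms of lower degree decay, those of
  higher degree vanish, and the term of degree \<open>k\<close> is constant.\<close>

lemma F_scaled_tendsto:
  assumes "k \<in> {1..n}" and zero: "\<And>j. j \<in> {k<..n} \<Longrightarrow> f j x = 0"
  shows "((\<lambda>y. F n f 0 x y * exp (- (real k * y))) \<longlongrightarrow> f k x) at_top"
proof -
  have "((\<lambda>y. f i x * exp ((real i - real k) * y)) \<longlongrightarrow> (if i = k then f k x else 0)) at_top"
    if "i \<in> {1..n}" for i
  proof (cases "i < k")
    case True
    then have "filterlim (\<lambda>y. (real i - real k) * y) at_bot at_top"
      by (intro filterlim_tendsto_neg_mult_at_bot[OF tendsto_const _ filterlim_ident]) auto
    then have "((\<lambda>y. exp ((real i - real k) * y)) \<longlongrightarrow> 0) at_top"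
      by (rule filterlim_compose[OF exp_at_bot])
    then show ?thesis using True tendsto_mult_right_zero by auto
  next
    case False
    then show ?thesis using that zero[of i] by auto
  qed
  then have "((\<lambda>y. \<Sum>i=1..n. f i x * exp ((real i - real k) * y))
      \<longlongrightarrow> (\<Sum>i=1..n. if i = k then f k x else 0)) at_top"
    by (rule tendsto_sum)
  moreover have "(\<Sum>i=1..n. f i x * exp ((real i - real k) * y)) = F n f 0 x y * exp (- (real k * y))" for y
  proof -
    have "exp ((real i - real k) * y) = exp (real i * y) * exp (- (real k * y))" for i
      by (simp add: exp_add[symmetric] algebra_simps)
    then show ?thesis by (simp add: F_def sum_distrib_right mult.assoc)
  qed
  ultimately show ?thesis using assms(1) by simp
qed

lemma F_lead_pos_growth:
  assumes "lead_pos n f x"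
  shows "\<exists>a>0. \<forall>\<^sub>F y in at_top. a * exp y \<le> F n f 0 x y"
proof -
  obtain k where k: "k \<in> {1..n}" "f k x > 0" "\<And>j. j \<in> {k<..n} \<Longrightarrow> f j x = 0"
    using assms by (auto simp: lead_pos_def)
  have "\<forall>\<^sub>F y in at_top. f k x / 2 < F n f 0 x y * exp (- (real k * y))"
    using F_scaled_tendsto[of k n f x] k by (intro order_tendstoD) auto
  moreover have "\<forall>\<^sub>F y::real in at_top. 0 \<le> y" by (rule eventually_ge_at_top)
  ultimately have "\<forall>\<^sub>F y in at_top. f k x / 2 * exp y \<le> F n f 0 x y"
  proof eventually_elim
    case (elim y)
    \<comment> \<open>Degrees start at 1, so the common rate \<open>exp y\<close> serves every
      leading degree \<open>k\<close>.\<close>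
    have "exp y \<le> exp (real k * y)" using k(1) elim(2) by (simp add: mult_le_cancel_right1)
    then have "f k x / 2 * exp y \<le> f k x / 2 * exp (real k * y)" using k(2) by simp
    also have "\<dots> \<le> F n f 0 x y" using elim(1) by (simp add: exp_minus field_simps)
    finally show ?case .
  qed
  then show ?thesis using k(2) by (intro exI[of _ "f k x / 2"]) auto
qed

text \<open>Unless all coefficients vanish at \<open>x\<close>, the one of highest degree is
  negative, and the growth estimate applies to \<open>- f\<close>.\<close>

lemma F_not_lead_pos_cases:
  assumes "\<not> lead_pos n f x"
  shows "(\<forall>y. F n f 0 x y = 0) \<or> (\<exists>a<0. \<forall>\<^sub>F y in at_top. F n f 0 x y \<le> a * exp y)"
proof (cases "\<exists>k\<in>{1..n}. f k x \<noteq> 0")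
  case False
  then show ?thesis by (simp add: F_def)
next
  case True
  define k where "k = Max {k\<in>{1..n}. f k x \<noteq> 0}"
  have "k \<in> {k\<in>{1..n}. f k x \<noteq> 0}"
    unfolding k_def using True by (intro Max_in) auto
  then have k: "k \<in> {1..n}" "f k x \<noteq> 0" by auto
  have zero: "f j x = 0" if "j \<in> {k<..n}" for j
  proof (rule ccontr)
    assume "f j x \<noteq> 0"
    then have "j \<le> k" unfolding k_def using that k(1) by (intro Max_ge) auto
    then show False using that by simp
  qed
  have "f k x < 0" using assms k zero unfolding lead_pos_def by (meson linorder_neqE_linordered_idom)
  moreover have "\<forall>j\<in>{k<..n}. - f j x = 0" using zero by simp
  ultimately have "lead_pos n (\<lambda>i x. - f i x) x" using k(1) by (auto simp: lead_pos_def)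
  then obtain a where "a > 0" "\<forall>\<^sub>F y in at_top. a * exp y \<le> F n (\<lambda>i x. - f i x) 0 x y"
    using F_lead_pos_growth[of n "\<lambda>i x. - f i x" x] by blast
  then have "\<forall>\<^sub>F y in at_top. F n f 0 x y \<le> (- a) * exp y"
    by (simp add: F_def sum_negf le_minus_iff)
  then show ?thesis using \<open>a > 0\<close> by (intro disjI2 exI[of _ "- a"]) auto
qed

text \<open>Exponential growth beats every affine function, with one \<open>M\<close> for the
  finitely many vertices. Affine functions are the right competitors because
  \<open>- \<Delta> u\<close> is at most a multiple of the oscillation of \<open>u\<close>.\<close>

lemma F_lead_pos_superlinear:
  fixes f :: "nat \<Rightarrow> 'v::finite \<Rightarrow> real"
  shows "\<exists>M. \<forall>x. lead_pos n f x \<longrightarrow> (\<forall>y\<ge>M. D * y + b < F n f 0 x y)"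
proof -
  have "\<forall>\<^sub>F y in at_top. lead_pos n f x \<longrightarrow> D * y + b < F n f 0 x y" for x
  proof (cases "lead_pos n f x")
    case True
    then obtain a where a: "a > 0" "\<forall>\<^sub>F y in at_top. a * exp y \<le> F n f 0 x y"
      using F_lead_pos_growth[OF True] by blast
    have "((\<lambda>y::real. D * (y ^ 1 / exp y) + b * (y ^ 0 / exp y)) \<longlongrightarrow> D * 0 + b * 0) at_top"
      by (intro tendsto_intros tendsto_power_div_exp_0)
    then have "\<forall>\<^sub>F y in at_top. D * (y ^ 1 / exp y) + b * (y ^ 0 / exp y) < a"
      using a(1) by (intro order_tendstoD) auto
    with a(2) show ?thesis
    proof eventually_elim
      case (elim y)
      have "D * y + b < a * exp y" using elim(2) by (simp add: field_simps)
      then show ?case using elim(1) by simp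
    qed
  qed simp
  then have "\<forall>\<^sub>F y in at_top. \<forall>x. lead_pos n f x \<longrightarrow> D * y + b < F n f 0 x y"
    by (intro eventually_all_finite)
  then show ?thesis unfolding eventually_at_top_linorder by blast
qed

lemma F_not_lead_pos_nonpos:
  fixes f :: "nat \<Rightarrow> 'v::finite \<Rightarrow> real"
  shows "\<exists>M. \<forall>x. \<not> lead_pos n f x \<longrightarrow> (\<forall>y\<ge>M. F n f 0 x y \<le> 0)"
proof -
  have "\<forall>\<^sub>F y in at_top. \<not> lead_pos n f x \<longrightarrow> F n f 0 x y \<le> 0" for x
  proof (cases "lead_pos n f x")
    case False
    show ?thesis
    proof (rule disjE[OF F_not_lead_pos_cases[OF False]])
      assume "\<exists>a<0. \<forall>\<^sub>F y in at_top. F n f 0 x y \<le> a * exp y"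
      then obtain a where a: "a < 0" "\<forall>\<^sub>F y in at_top. F n f 0 x y \<le> a * exp y" by blast
      have "a * exp y \<le> 0" for y using a(1) by (simp add: mult_le_0_iff)
      then show ?thesis using a(2) by (auto elim!: eventually_mono intro: order_trans)
    qed simp
  qed simp
  then have "\<forall>\<^sub>F y in at_top. \<forall>x. \<not> lead_pos n f x \<longrightarrow> F n f 0 x y \<le> 0"
    by (intro eventually_all_finite)
  then show ?thesis unfolding eventually_at_top_linorder by blast
qed

text \<open>Each exponent is at least 1, so a factor \<open>exp y\<close> splits off and the rest is
  at most \<open>exp (n * L)\<close>. This yields both smallness near minus infinity and boundedness
  on half-lines.\<close>

lemma F_abs_bound:
  fixes f :: "nat \<Rightarrow> 'v::finite \<Rightarrow> real"
  shows "\<exists>A>0. \<forall>x y L. y \<le> L \<longrightarrow> 0 \<le> L \<longrightarrow> \<bar>F n f 0 x y\<bar> \<le> A * exp (real n * L + y)"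
proof -
  define A where "A = (\<Sum>x\<in>UNIV. \<Sum>i=1..n. \<bar>f i x\<bar>) + 1"
  have A: "A > 0" unfolding A_def by (intro add_nonneg_pos sum_nonneg) auto
  have "\<bar>F n f 0 x y\<bar> \<le> A * exp (real n * L + y)" if L: "y \<le> L" "0 \<le> L" for x y L
  proof -
    have "\<bar>F n f 0 x y\<bar> \<le> (\<Sum>i=1..n. \<bar>f i x\<bar> * exp (real i * y))"
      unfolding F_def by (rule order_trans[OF _ order_trans[OF sum_abs]]) (auto simp: abs_mult)
    also have "\<dots> \<le> (\<Sum>i=1..n. \<bar>f i x\<bar> * exp (real n * L + y))"
    proof (intro sum_mono mult_left_mono)
      fix i assume i: "i \<in> {1..n}"
      have "(real i - 1) * y \<le> (real i - 1) * L" using i L by (intro mult_left_mono) auto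
      also have "\<dots> \<le> real n * L" using i L by (intro mult_right_mono) auto
      finally show "exp (real i * y) \<le> exp (real n * L + y)" by (simp add: algebra_simps)
    qed auto
    also have "\<dots> = (\<Sum>i=1..n. \<bar>f i x\<bar>) * exp (real n * L + y)" by (simp add: sum_distrib_right)
    also have "\<dots> \<le> A * exp (real n * L + y)"
    proof (intro mult_right_mono)
      have "(\<Sum>i=1..n. \<bar>f i x\<bar>) \<le> (\<Sum>x\<in>UNIV. \<Sum>i=1..n. \<bar>f i x\<bar>)"
        by (rule member_le_sum) (auto intro: sum_nonneg)
      then show "(\<Sum>i=1..n. \<bar>f i x\<bar>) \<le> A" by (simp add: A_def)
    qed auto
    finally show ?thesis .
  qed
  then show ?thesis using A by blast
qed

lemma F_small:
  fixes f :: "nat \<Rightarrow> 'v::finite \<Rightarrow> real"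
  assumes "\<epsilon> > 0"
  shows "\<exists>M. \<forall>x. \<forall>y\<le>M. \<bar>F n f 0 x y\<bar> < \<epsilon>"
proof -
  obtain A where A: "A > 0" "\<And>x y L. y \<le> L \<Longrightarrow> 0 \<le> L \<Longrightarrow> \<bar>F n f 0 x y\<bar> \<le> A * exp (real n * L + y)"
    using F_abs_bound[of n f] by blast
  have "\<bar>F n f 0 x y\<bar> < \<epsilon>" if y: "y \<le> min 0 (ln (\<epsilon> / (2 * A)))" for x y
  proof -
    have "exp y \<le> exp (ln (\<epsilon> / (2 * A)))" using y by simp
    then have "exp y \<le> \<epsilon> / (2 * A)" using A(1) assms by simp
    then have "A * exp y \<le> \<epsilon> / 2" using A(1) by (simp add: field_simps)
    moreover have "\<bar>F n f 0 x y\<bar> \<le> A * exp y" using A(2)[of y 0 x] y by simp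
    ultimately show ?thesis using assms by linarith
  qed
  then show ?thesis by blast
qed

lemma F_bounded_atMost:
  fixes f :: "nat \<Rightarrow> 'v::finite \<Rightarrow> real"
  shows "\<exists>B\<ge>0. \<forall>x. \<forall>y\<le>L. \<bar>F n f 0 x y\<bar> \<le> B"
proof -
  obtain A where A: "A > 0" "\<And>x y L. y \<le> L \<Longrightarrow> 0 \<le> L \<Longrightarrow> \<bar>F n f 0 x y\<bar> \<le> A * exp (real n * L + y)"
    using F_abs_bound[of n f] by blast
  let ?L = "max L 0"
  have "\<bar>F n f 0 x y\<bar> \<le> A * exp (real n * ?L + ?L)" if "y \<le> L" for x y
  proof -
    have "\<bar>F n f 0 x y\<bar> \<le> A * exp (real n * ?L + y)" using A(2)[of y ?L x] that by simp
    also have "\<dots> \<le> A * exp (real n * ?L + ?L)" using A(1) that by simp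
    finally show ?thesis .
  qed
  then show ?thesis using A(1) by (intro exI[of _ "A * exp (real n * ?L + ?L)"]) auto
qed

lemma F_not_lead_pos_bounded_above:
  fixes f :: "nat \<Rightarrow> 'v::finite \<Rightarrow> real"
  shows "\<exists>B\<ge>0. \<forall>x. \<not> lead_pos n f x \<longrightarrow> (\<forall>y. F n f 0 x y \<le> B)"
proof -
  obtain M where M: "\<And>x y. \<not> lead_pos n f x \<Longrightarrow> M \<le> y \<Longrightarrow> F n f 0 x y \<le> 0"
    using F_not_lead_pos_nonpos[of n f] by blast
  obtain B where B: "B \<ge> 0" "\<And>x y. y \<le> M \<Longrightarrow> \<bar>F n f 0 x y\<bar> \<le> B"
    using F_bounded_atMost[of M n f] by blast
  have "F n f 0 x y \<le> B" if "\<not> lead_pos n f x" for x y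
    using M[OF that, of y] B(1) B(2)[of y x] by linarith
  then show ?thesis using B(1) by blast
qed

section \<open>Limits at infinity and the finiteness of \<open>q\<close>\<close>

lemma Lim_F_lead_pos:
  assumes "lead_pos n f x"
  shows "Lim at_top (\<lambda>y. ereal (F n f c x y)) = \<infinity>"
proof -
  obtain a where a: "a > 0" "\<forall>\<^sub>F y in at_top. a * exp y \<le> F n f 0 x y"
    using F_lead_pos_growth[OF assms] by blast
  have "filterlim (\<lambda>y::real. a * exp y) at_top at_top"
    by (rule filterlim_tendsto_pos_mult_at_top[OF tendsto_const a(1) exp_at_top])
  then have "filterlim (F n f 0 x) at_top at_top" by (rule filterlim_at_top_mono[OF _ a(2)])
  then have "filterlim (\<lambda>y. c + F n f 0 x y) at_top at_top"
    by (rule filterlim_tendsto_add_at_top[OF tendsto_const])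
  then have "((\<lambda>y. ereal (F n f c x y)) \<longlongrightarrow> \<infinity>) at_top"
    by (subst F_shift) (simp add: tendsto_PInfty_eq_at_top add.commute)
  then show ?thesis by (intro tendsto_Lim) auto
qed

lemma Lim_F_not_lead_pos:
  assumes "\<not> lead_pos n f x"
  shows "Lim at_top (\<lambda>y. ereal (F n f c x y)) < \<infinity>"
  using F_not_lead_pos_cases[OF assms]
proof
  assume "\<forall>y. F n f 0 x y = 0"
  then have "(\<lambda>y. ereal (F n f c x y)) = (\<lambda>y. ereal c)" by (subst F_shift) simp
  then have "Lim at_top (\<lambda>y. ereal (F n f c x y)) = ereal c" by (auto intro!: tendsto_Lim)
  then show ?thesis by simp
next
  assume "\<exists>a<0. \<forall>\<^sub>F y in at_top. F n f 0 x y \<le> a * exp y"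
  then obtain a where a: "a < 0" "\<forall>\<^sub>F y in at_top. F n f 0 x y \<le> a * exp y" by blast
  have "filterlim (\<lambda>y::real. a * exp y) at_bot at_top"
    by (rule filterlim_tendsto_neg_mult_at_bot[OF tendsto_const a(1) exp_at_top])
  then have "filterlim (F n f 0 x) at_bot at_top" by (rule filterlim_at_bot_mono[OF _ a(2)])
  then have "filterlim (\<lambda>y. - c + - F n f 0 x y) at_top at_top"
    by (intro filterlim_tendsto_add_at_top[OF tendsto_const]) (simp add: filterlim_uminus_at_top)
  then have "filterlim (\<lambda>y. c + F n f 0 x y) at_bot at_top"
    by (subst filterlim_uminus_at_bot) simp
  then have "((\<lambda>y. ereal (F n f c x y)) \<longlongrightarrow> - \<infinity>) at_top"
    by (subst F_shift) (simp add: tendsto_MInfty filterlim_at_bot_dense add.commute)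
  then have "Lim at_top (\<lambda>y. ereal (F n f c x y)) = - \<infinity>" by (intro tendsto_Lim) auto
  then show ?thesis by simp
qed

lemma q_infinite_iff: "q n f c = \<infinity> \<longleftrightarrow> (\<exists>x. lead_pos n f x)"
proof -
  let ?L = "\<lambda>x. Lim at_top (\<lambda>y. ereal (F n f c x y))"
  have "Max (range ?L) \<in> range ?L" by (rule Max_in) auto
  moreover have "?L x \<le> Max (range ?L)" for x by (rule Max_ge) auto
  ultimately show ?thesis
    unfolding q_def using Lim_F_lead_pos[of n f _ c] Lim_F_not_lead_pos[of n f _ c]
    by (smt (verit) ereal_infty_less_eq(1) less_irrefl rangeE)
qed

section \<open>The graph Laplacian\<close>

context finite_connected_weighted_graph
begin

lemma laplacian_eq_sum_UNIV: "laplacian E \<omega> m u x = (\<Sum>y\<in>UNIV. \<omega> x y * (u y - u x)) / m x"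
proof -
  have "\<omega> x y = 0" if "{x, y} \<notin> E" for y
    using that edge_weight_pos_iff[of x y] edge_weight_nonneg[of x y] by linarith
  then have "(\<Sum>y | {x, y} \<in> E. \<omega> x y * (u y - u x)) = (\<Sum>y\<in>UNIV. \<omega> x y * (u y - u x))"
    by (intro sum.mono_neutral_left) auto
  then show ?thesis by (simp add: laplacian_def)
qed

text \<open>Where the functions touch, only the neighbouring values differ, and these enter with
  nonnegative weights. This is the source of all maximum principle arguments here.\<close>

lemma laplacian_mono_at:
  assumes "\<And>y. u y \<le> v y" and "u x = v x"
  shows "laplacian E \<omega> m u x \<le> laplacian E \<omega> m v x"
  unfolding laplacian_eq_sum_UNIV
  using assms vertex_weight_pos[of x] edge_weight_nonneg
  by (intro divide_right_mono sum_mono mult_left_mono) (auto simp: less_imp_le)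

lemma laplacian_affine:
  "laplacian E \<omega> m (\<lambda>x. a + b * u x) x = b * laplacian E \<omega> m u x"
  by (simp add: laplacian_eq_sum_UNIV sum_distrib_left algebra_simps)

lemma laplacian_const: "laplacian E \<omega> m (\<lambda>x. a) x = 0"
  by (simp add: laplacian_def)

lemma laplacian_uminus: "laplacian E \<omega> m (\<lambda>x. - u x) x = - laplacian E \<omega> m u x"
  using laplacian_affine[of 0 "-1" u x] by simp

lemma laplacian_at_max:
  assumes "\<And>y. u y \<le> u x" shows "laplacian E \<omega> m u x \<le> 0"
  using laplacian_mono_at[of u "\<lambda>_. u x" x] assms by (simp add: laplacian_const)

lemma laplacian_at_min:
  assumes "\<And>y. u x \<le> u y" shows "laplacian E \<omega> m u x \<ge> 0"
  using laplacian_mono_at[of "\<lambda>_. u x" u x] assms by (simp add: laplacian_const)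

text \<open>By symmetry of \<open>\<omega>\<close>, exchanging the summation variables turns the
  weighted double sum into its negative.\<close>

lemma average_laplacian: "average m (laplacian E \<omega> m u) = 0"
proof -
  let ?S = "\<Sum>x\<in>UNIV. \<Sum>y\<in>UNIV. \<omega> x y * (u y - u x)"
  have "m x * laplacian E \<omega> m u x = (\<Sum>y\<in>UNIV. \<omega> x y * (u y - u x))" for x
    using vertex_weight_pos[of x] by (simp add: laplacian_eq_sum_UNIV)
  then have "average m (laplacian E \<omega> m u) = ?S / (\<Sum>x\<in>UNIV. m x)" by (simp add: average_def)
  moreover have "?S = - ?S"
  proof -
    have "?S = (\<Sum>x\<in>UNIV. \<Sum>y\<in>UNIV. \<omega> y x * (u x - u y))" by (rule sum.swap)
    also have "\<dots> = (\<Sum>x\<in>UNIV. \<Sum>y\<in>UNIV. - (\<omega> x y * (u y - u x)))"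
      using edge_weight_sym by (intro sum.cong refl) (simp add: algebra_simps)
    also have "\<dots> = - ?S" by (simp add: sum_negf)
    finally show ?thesis .
  qed
  then have "?S = 0" by linarith
  ultimately show ?thesis by simp
qed

lemma total_weight_pos: "(\<Sum>x\<in>UNIV. m x) > 0"
  using vertex_weight_pos by (intro sum_pos) auto

lemma average_const: "average m (\<lambda>x. a) = a"
  using total_weight_pos by (simp add: average_def sum_distrib_right[symmetric])

lemma average_diff: "average m (\<lambda>x. f x - g x) = average m f - average m g"
  by (simp add: average_def sum_subtractf right_diff_distrib diff_divide_distrib)

lemma obtain_min: obtains z where "\<And>y. (u :: 'v \<Rightarrow> real) z \<le> u y"
proof -
  have "Min (range u) \<in> range u" by (rule Min_in) auto
  then obtain z where "u z = Min (range u)" by force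
  then have "u z \<le> u y" for y by simp
  then show ?thesis using that by blast
qed

lemma obtain_max: obtains z where "\<And>y. (u :: 'v \<Rightarrow> real) y \<le> u z"
  using obtain_min[of "\<lambda>x. - u x"] by auto

text \<open>The bound on the Laplacian is only required where \<open>u\<close> is already known to be close to
  its minimum; it spreads along edges, each step enlarging the bound by a fixed factor.\<close>

lemma oscillation_bound:
  "\<exists>K\<ge>0. \<forall>u B z. B \<ge> 0 \<longrightarrow> (\<forall>y. u z \<le> u y) \<longrightarrow>
     (\<forall>y. u y \<le> u z + K * B \<longrightarrow> laplacian E \<omega> m u y \<le> B) \<longrightarrow> (\<forall>y. u y \<le> u z + K * B)"
proof -
  let ?R = "{(a, b). {a, b} \<in> E}"
  \<comment> \<open>\<open>\<kappa>\<close> bounds the loss along any edge; terms with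
    \<open>\<omega> y w = 0\<close> are 0 by the convention for division. The sequence
    \<open>r\<close> solves \<open>r (Suc k) = r k + \<kappa> * (r k + 1)\<close> with
    \<open>r 0 = 0\<close>.\<close>
  define \<kappa> where "\<kappa> = (\<Sum>y\<in>UNIV. \<Sum>w\<in>UNIV. (m y + (\<Sum>v\<in>UNIV. \<omega> y v)) / \<omega> y w)"
  define N where "N = card ?R"
  define r where "r k = (1 + \<kappa>) ^ k - 1" for k :: nat
  have nn: "(m y + (\<Sum>v\<in>UNIV. \<omega> y v)) / \<omega> y w \<ge> 0" for y w
    using vertex_weight_pos[of y] edge_weight_nonneg
    by (intro divide_nonneg_nonneg add_nonneg_nonneg sum_nonneg) (auto simp: less_imp_le)
  have \<kappa>_nonneg: "\<kappa> \<ge> 0" unfolding \<kappa>_def by (intro sum_nonneg nn)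
  have r_mono: "r k \<le> r l" if "k \<le> l" for k l
    using that \<kappa>_nonneg by (simp add: r_def power_increasing)
  have r_nonneg: "r k \<ge> 0" for k using r_mono[of 0 k] by (simp add: r_def)
  have \<kappa>_ge: "m y + (\<Sum>v\<in>UNIV. \<omega> y v) \<le> \<kappa> * \<omega> y w" if "\<omega> y w > 0" for y w
  proof -
    have "(m y + (\<Sum>v\<in>UNIV. \<omega> y v)) / \<omega> y w \<le> (\<Sum>w\<in>UNIV. (m y + (\<Sum>v\<in>UNIV. \<omega> y v)) / \<omega> y w)"
      by (rule member_le_sum) (auto intro: nn)
    also have "\<dots> \<le> \<kappa>"
      unfolding \<kappa>_def by (rule member_le_sum) (auto intro: nn sum_nonneg)
    finally show ?thesis using that by (simp add: field_simps)
  qed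
  have "u y \<le> u z + r N * B"
    if B: "B \<ge> 0" and z: "\<And>y. u z \<le> u y"
      and lap: "\<And>y. u y \<le> u z + r N * B \<Longrightarrow> laplacian E \<omega> m u y \<le> B" for u B z y
  proof -
    have step: "u y \<le> u z + r k * B" if "(z, y) \<in> ?R ^^ k" "k \<le> N" for k y
      using that
    proof (induction k arbitrary: y)
      case 0
      then show ?case by (simp add: r_def)
    next
      case (Suc k)
      then obtain x where x: "(z, x) \<in> ?R ^^ k" and "{x, y} \<in> E" by auto
      then have \<omega>: "\<omega> x y > 0" using edge_weight_pos_iff by blast
      have ux: "u x \<le> u z + r k * B" using Suc x by simp
      also have "\<dots> \<le> u z + r N * B"
        using r_mono[of k N] Suc.prems B by (simp add: mult_right_mono)
      finally have "laplacian E \<omega> m u x \<le> B" by (rule lap)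
      then have *: "(\<Sum>v\<in>UNIV. \<omega> x v * (u v - u x)) \<le> m x * B"
        using vertex_weight_pos[of x] by (simp add: laplacian_eq_sum_UNIV divide_le_eq mult.commute)
      \<comment> \<open>As \<open>z\<close> is a minimum, every term of the sum is nonnegative, so a
        single neighbour is controlled by the whole sum.\<close>
      have "\<omega> x y * (u y - u z) \<le> (\<Sum>v\<in>UNIV. \<omega> x v * (u v - u z))"
        using edge_weight_nonneg z by (intro member_le_sum mult_nonneg_nonneg) auto
      also have "\<dots> = (\<Sum>v\<in>UNIV. \<omega> x v * (u v - u x)) + (\<Sum>v\<in>UNIV. \<omega> x v) * (u x - u z)"
        by (simp add: sum_distrib_right flip: sum.distrib) (simp add: algebra_simps)
      also have "\<dots> \<le> m x * B + (\<Sum>v\<in>UNIV. \<omega> x v) * (r k * B)"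
        using * ux edge_weight_nonneg by (intro add_mono mult_left_mono sum_nonneg) auto
      finally have A: "\<omega> x y * (u y - u z) \<le> m x * B + (\<Sum>v\<in>UNIV. \<omega> x v) * (r k * B)" .
      have "m x * B + (\<Sum>v\<in>UNIV. \<omega> x v) * (r k * B)
          \<le> (m x + (\<Sum>v\<in>UNIV. \<omega> x v)) * (r k * B + B)"
      proof -
        have "0 \<le> m x * (r k * B)" "0 \<le> (\<Sum>v\<in>UNIV. \<omega> x v) * B"
          using vertex_weight_pos[of x] edge_weight_nonneg B r_nonneg[of k]
          by (auto intro!: mult_nonneg_nonneg sum_nonneg simp: less_imp_le)
        then show ?thesis by (simp add: algebra_simps)
      qed
      also have "\<dots> \<le> (\<kappa> * \<omega> x y) * (r k * B + B)"
        using \<kappa>_ge[OF \<omega>] B r_nonneg[of k] by (intro mult_right_mono) auto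
      finally have "\<omega> x y * (u y - u z) \<le> \<omega> x y * (\<kappa> * (r k * B + B))"
        using A by (simp add: mult_ac)
      then have "u y - u z \<le> \<kappa> * (r k * B + B)" using \<omega> by simp
      also have "\<dots> \<le> r (Suc k) * B"
        using B r_nonneg[of k] mult_nonneg_nonneg[OF r_nonneg[of k] B]
        by (simp add: r_def algebra_simps)
      finally show ?case by simp
    qed
    \<comment> \<open>In a finite relation, reachability is witnessed by a path of length at most
      its cardinality \<open>N\<close>.\<close>
    have "finite ?R" by (rule finite_subset[OF subset_UNIV]) simp
    then obtain k where k: "k \<le> N" "(z, y) \<in> ?R ^^ k"
      using connected[of z y] unfolding N_def by (auto simp: rtrancl_finite_eq_relpow)
    then show ?thesis
      using step[OF k(2,1)] r_mono[OF k(1)] B by (meson add_left_mono mult_right_mono order_trans)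
  qed
  then show ?thesis using r_nonneg[of N] by (intro exI[of _ "r N"]) blast
qed

text \<open>Adding the average to \<open>- \<Delta>\<close> gives a linear map \<open>T\<close> that
  preserves averages. Its kernel consists of harmonic functions with average 0, hence is trivial, so
  \<open>T\<close> is onto. A preimage of \<open>f\<close> has average 0 and therefore solves the
  equation.\<close>

lemma poisson_solvable:
  assumes "average m f = 0"
  shows "\<exists>v. \<forall>x. - laplacian E \<omega> m v x = f x"
proof -
  define T :: "real^'v \<Rightarrow> real^'v" where
    "T v = (\<chi> x. - laplacian E \<omega> m (($) v) x + average m (($) v))" for v
  have lin: "linear T"
  proof (rule linearI)
    show "T (u + v) = T u + T v" for u v
      by (simp add: T_def vec_eq_iff laplacian_eq_sum_UNIV average_def algebra_simps
          sum.distrib sum_subtractf add_divide_distrib diff_divide_distrib)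
    show "T (c *\<^sub>R v) = c *\<^sub>R T v" for c v
      by (simp add: T_def vec_eq_iff laplacian_eq_sum_UNIV average_def algebra_simps
          sum_distrib_left sum_subtractf add_divide_distrib diff_divide_distrib)
  qed
  have T_fun: "($) (T v) = (\<lambda>x. average m (($) v) - laplacian E \<omega> m (($) v) x)" for v
    by (auto simp: T_def)
  have avg_T: "average m (($) (T v)) = average m (($) v)" for v
    unfolding T_fun using average_laplacian[of "($) v"] average_diff[of "\<lambda>_. average m (($) v)" "laplacian E \<omega> m (($) v)"]
    by (simp add: average_const)
  have "inj T"
  proof (subst linear_injective_0[OF lin], intro allI impI)
    fix v assume v: "T v = 0"
    have "average m (($) (T v)) = 0" unfolding v by (simp add: average_def)
    then have avg: "average m (($) v) = 0" using avg_T by simp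
    have lap: "laplacian E \<omega> m (($) v) x = 0" for x
      using arg_cong[OF v, of "\<lambda>w. w $ x"] avg by (simp add: T_def)
    obtain z where z: "\<And>y. v $ z \<le> v $ y" using obtain_min[of "($) v"] by blast
    have "v $ y = v $ z" for y
    proof -
      \<comment> \<open>For \<open>B = 0\<close> the oscillation bound says that harmonic functions
        are constant.\<close>
      obtain K where "\<And>u B z y. B \<ge> 0 \<Longrightarrow> (\<And>y. u z \<le> u y) \<Longrightarrow>
          (\<And>y. u y \<le> u z + K * B \<Longrightarrow> laplacian E \<omega> m u y \<le> B) \<Longrightarrow> u y \<le> u z + K * B"
        using oscillation_bound by metis
      from this[of 0 "($) v" z y] show ?thesis using z[of y] z lap by simp
    qed
    then have "($) v = (\<lambda>_. v $ z)" by auto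
    then have "v $ z = 0" using avg average_const[of "v $ z"] by simp
    then show "v = 0" using \<open>\<And>y. v $ y = v $ z\<close> by (simp add: vec_eq_iff)
  qed
  then have "surj T" using linear_injective_imp_surjective[OF lin] by blast
  then obtain v where v: "T v = (\<chi> x. f x)" by (metis surjD)
  moreover have "(($) (\<chi> x. f x)) = f" by auto
  ultimately have "average m (($) v) = 0" using avg_T[of v] assms by metis
  then have "- laplacian E \<omega> m (($) v) x = f x" for x
    using arg_cong[OF v, of "\<lambda>w. w $ x"] by (simp add: T_def)
  then show ?thesis by blast
qed

section \<open>A priori bounds and multiplicity\<close>

abbreviation sol :: "nat \<Rightarrow> (nat \<Rightarrow> 'v \<Rightarrow> real) \<Rightarrow> real \<Rightarrow> ('v \<Rightarrow> real) \<Rightarrow> bool" where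
  "sol \<equiv> is_solution E \<omega> m"

text \<open>The equation as a zero problem on \<open>real^'v\<close>, where Brouwer's theorem and
  compactness of boxes are available.\<close>

definition residual :: "nat \<Rightarrow> (nat \<Rightarrow> 'v \<Rightarrow> real) \<Rightarrow> real \<Rightarrow> real^'v \<Rightarrow> real^'v" where
  "residual n f c u = (\<chi> x. - laplacian E \<omega> m (($) u) x - F n f 0 x (u $ x) - c)"

lemma residual_eq_0_iff: "residual n f c u = 0 \<longleftrightarrow> sol n f c (($) u)"
  by (simp add: residual_def vec_eq_iff is_solution_iff algebra_simps)

lemma continuous_on_residual [continuous_intros]:
  assumes "continuous_on S c" "continuous_on S u"
  shows "continuous_on S (\<lambda>p. residual n f (c p) (u p))"
  unfolding residual_def laplacian_eq_sum_UNIV F_def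
  using assms vertex_weight_pos by (intro continuous_intros) (auto simp: less_imp_neq[symmetric])

text \<open>Comparison of the Laplacians at the touching point. Keeping the defect of
  \<open>b\<close> as the bound serves weak and strict supersolutions alike.\<close>

lemma residual_upper:
  assumes "- laplacian E \<omega> m b x \<ge> F n f 0 x (b x) + c" "\<And>y. u $ y \<le> b y" "u $ x = b x"
  shows "residual n f c u $ x \<ge> - laplacian E \<omega> m b x - (F n f 0 x (b x) + c)"
  using laplacian_mono_at[of "($) u" b x] assms by (simp add: residual_def)

lemma residual_lower:
  assumes "- laplacian E \<omega> m a x \<le> F n f 0 x (a x) + c" "\<And>y. a y \<le> u $ y" "u $ x = a x"
  shows "residual n f c u $ x \<le> - laplacian E \<omega> m a x - (F n f 0 x (a x) + c)"
  using laplacian_mono_at[of a "($) u" x] assms by (simp add: residual_def)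

section \<open>Solutions inside and outside an order box\<close>

lemma sub_super_solution:
  assumes ab: "\<And>x. a x \<le> b x"
    and super: "\<And>x. - laplacian E \<omega> m b x \<ge> F n f 0 x (b x) + c"
    and sub: "\<And>x. - laplacian E \<omega> m a x \<le> F n f 0 x (a x) + c"
  shows "\<exists>u. sol n f c u \<and> (\<forall>x. a x \<le> u x \<and> u x \<le> b x)"
proof -
  let ?a = "\<chi> x. a x" and ?b = "\<chi> x. b x"
  have "\<exists>u\<in>cbox ?a ?b. residual n f c u = 0"
  proof (rule box_zero_exists)
    show "continuous_on (cbox ?a ?b) (residual n f c)"
      by (intro continuous_intros)
    show "residual n f c u $ x \<ge> 0" if "u \<in> cbox ?a ?b" "u $ x = ?b $ x" for u x
      using residual_upper[OF super, of u x] super[of x] that by (simp add: mem_box_cart)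
    show "residual n f c u $ x \<le> 0" if "u \<in> cbox ?a ?b" "u $ x = ?a $ x" for u x
      using residual_lower[OF sub, of u x] sub[of x] that by (simp add: mem_box_cart)
  qed (use ab in simp)
  then show ?thesis by (auto simp: residual_eq_0_iff mem_box_cart)
qed

text \<open>The constant term moves along the segment from \<open>c\<close> to \<open>C\<close>,
  where there is no solution; strictness of \<open>a\<close> and \<open>b\<close> gives the boundary
  signs at \<open>c\<close>.\<close>

lemma solution_outside_box:
  assumes ab: "\<And>x. a x < b x"
    and super: "\<And>x. - laplacian E \<omega> m b x > F n f 0 x (b x) + c"
    and sub: "\<And>x. - laplacian E \<omega> m a x < F n f 0 x (a x) + c"
    and bound: "\<And>s u x. s \<in> {0..1} \<Longrightarrow> sol n f (c + s * (C - c)) u \<Longrightarrow> \<bar>u x\<bar> \<le> R"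
    and no_solution: "\<And>u. \<not> sol n f C u"
  shows "\<exists>v. sol n f c v \<and> \<not> (\<forall>x. a x \<le> v x \<and> v x \<le> b x)"
proof -
  let ?a = "\<chi> x. a x" and ?b = "\<chi> x. b x"
  let ?G = "\<lambda>s. residual n f (c + s * (C - c))"
  have "\<exists>u. u \<notin> cbox ?a ?b \<and> ?G 0 u = 0"
  proof (rule zero_outside_box_exists[where G = ?G and R = R])
    show "continuous_on ({0..1} \<times> UNIV) (\<lambda>(s, u). ?G s u)"
      unfolding split_beta by (intro continuous_intros)
    show "?G 0 u $ x > 0" if "u \<in> cbox ?a ?b" "u $ x = ?b $ x" for u x
      using residual_upper[OF less_imp_le[OF super], of u x] super[of x] that
      by (simp add: mem_box_cart)
    show "?G 0 u $ x < 0" if "u \<in> cbox ?a ?b" "u $ x = ?a $ x" for u x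
      using residual_lower[OF less_imp_le[OF sub], of u x] sub[of x] that
      by (simp add: mem_box_cart)
    show "\<bar>u $ x\<bar> \<le> R" if "s \<in> {0..1}" "?G s u = 0" for s u x
      using bound[of s "($) u" x] that by (simp add: residual_eq_0_iff)
    show "?G 1 u \<noteq> 0" for u
      using no_solution by (simp add: residual_eq_0_iff)
  qed (use ab in simp)
  then obtain u where "u \<notin> cbox ?a ?b" "residual n f c u = 0" by auto
  then show ?thesis by (auto simp: residual_eq_0_iff mem_box_cart intro!: exI[of _ "($) u"])
qed

text \<open>One solution lies in the box, the other outside. The location of \<open>v\<close> is
  recorded because it keeps these solutions from escaping to minus infinity as \<open>c\<close>
  tends to 0.\<close>

lemma two_solutions:
  assumes ab: "\<And>x. a x < b x"
    and super: "\<And>x. - laplacian E \<omega> m b x > F n f 0 x (b x) + c"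
    and sub: "\<And>x. - laplacian E \<omega> m a x < F n f 0 x (a x) + c"
    and bound: "\<And>s u x. s \<in> {0..1} \<Longrightarrow> sol n f (c + s * (C - c)) u \<Longrightarrow> \<bar>u x\<bar> \<le> R"
    and no_solution: "\<And>u. \<not> sol n f C u"
  shows "\<exists>u v. u \<noteq> v \<and> sol n f c u \<and> sol n f c v \<and> \<not> (\<forall>x. a x \<le> v x \<and> v x \<le> b x)"
proof -
  obtain u where u: "sol n f c u" "\<forall>x. a x \<le> u x \<and> u x \<le> b x"
    using sub_super_solution[of a b n f c] ab super sub by (meson less_imp_le)
  have "\<exists>v. sol n f c v \<and> \<not> (\<forall>x. a x \<le> v x \<and> v x \<le> b x)"
    by (rule solution_outside_box[where C = C and R = R]) (fact assms)+
  then obtain v where v: "sol n f c v" "\<not> (\<forall>x. a x \<le> v x \<and> v x \<le> b x)" by blast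
  have "u \<noteq> v" using u(2) v(2) by auto
  with u(1) v show ?thesis by blast
qed

lemma exists_least_gap:
  fixes g h :: "'v \<Rightarrow> real"
  assumes "\<And>x. g x < h x"
  shows "\<exists>d>0. \<forall>x. g x + d < h x"
proof -
  obtain z where z: "\<And>y. h z - g z \<le> h y - g y" using obtain_min[of "\<lambda>x. h x - g x"] by blast
  have "g x + (h z - g z) / 2 < h x" for x using z[of x] assms[of z] by (simp add: field_simps)
  then show ?thesis using assms[of z] by (intro exI[of _ "(h z - g z) / 2"]) auto
qed

text \<open>Each difference \<open>u x - u y\<close> is at most \<open>u x - u z\<close>, and
  \<open>D\<close> is the sum of the weighted degrees. This linear bound is played off against the
  exponential growth of \<open>F\<close>.\<close>

lemma neg_laplacian_le_oscillation:
  "\<exists>D\<ge>0. \<forall>u x z. (\<forall>y. u z \<le> u y) \<longrightarrow> - laplacian E \<omega> m u x \<le> D * (u x - u z)"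
proof -
  define d where "d x = (\<Sum>y\<in>UNIV. \<omega> x y) / m x" for x
  have d: "d x \<ge> 0" for x
    unfolding d_def using edge_weight_nonneg vertex_weight_pos[of x]
    by (intro divide_nonneg_nonneg sum_nonneg) (auto simp: less_imp_le)
  have "- laplacian E \<omega> m u x \<le> (\<Sum>x\<in>UNIV. d x) * (u x - u z)" if z: "\<And>y. u z \<le> u y" for u x z
  proof -
    have "- laplacian E \<omega> m u x = (\<Sum>y\<in>UNIV. \<omega> x y * (u x - u y)) / m x"
      unfolding laplacian_eq_sum_UNIV minus_divide_left sum_negf[symmetric]
      by (simp add: algebra_simps)
    also have "\<dots> \<le> (\<Sum>y\<in>UNIV. \<omega> x y * (u x - u z)) / m x"
      using z edge_weight_nonneg vertex_weight_pos[of x]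
      by (intro divide_right_mono sum_mono mult_left_mono) (auto simp: less_imp_le)
    also have "\<dots> = d x * (u x - u z)" by (simp add: d_def sum_distrib_right)
    also have "\<dots> \<le> (\<Sum>x\<in>UNIV. d x) * (u x - u z)"
      using d z by (intro mult_right_mono member_le_sum) auto
    finally show ?thesis .
  qed
  then show ?thesis using d by (intro exI[of _ "\<Sum>x\<in>UNIV. d x"]) (auto intro: sum_nonneg)
qed

lemma neg_laplacian_eq: "sol n f c u \<Longrightarrow> - laplacian E \<omega> m u x = F n f 0 x (u x) + c"
  by (simp add: is_solution_iff)

lemma solution_at_min: "sol n f c u \<Longrightarrow> (\<And>y. u z \<le> u y) \<Longrightarrow> F n f 0 z (u z) + c \<le> 0"
  using neg_laplacian_eq[of n f c u z] laplacian_at_min[of u z] by simp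

lemma solution_at_max: "sol n f c u \<Longrightarrow> (\<And>y. u y \<le> u z) \<Longrightarrow> F n f 0 z (u z) + c \<ge> 0"
  using neg_laplacian_eq[of n f c u z] laplacian_at_max[of u z] by simp

text \<open>Uniform in \<open>c\<close> down to \<open>c = 0\<close>: where the minimum of a solution is very negative the
  nonlinearity is negligible, so the solution is almost constant; otherwise it is bounded at
  the vertices with positive leading coefficient, and elsewhere its Laplacian is bounded below,
  so that a large maximum would spread to the former.\<close>

lemma a_priori_bound_lead_pos:
  assumes "lead_pos n f x0"
  shows "\<exists>M0 M1 K. \<forall>c u z. 0 \<le> c \<longrightarrow> c \<le> C \<longrightarrow> sol n f c u \<longrightarrow> (\<forall>y. u z \<le> u y) \<longrightarrow>
    (\<forall>y. u y \<le> M1) \<and> (u z \<ge> M0 \<or> (\<forall>y. u y \<le> u z + K))"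
proof -
  obtain K where K: "\<And>u B z y. B \<ge> 0 \<Longrightarrow> (\<And>y. u z \<le> u y) \<Longrightarrow>
      (\<And>y. u y \<le> u z + K * B \<Longrightarrow> laplacian E \<omega> m u y \<le> B) \<Longrightarrow> u y \<le> u z + K * B"
    using oscillation_bound by metis
  obtain D where D: "D \<ge> 0" "\<And>u x z. (\<And>y. u z \<le> u y) \<Longrightarrow> - laplacian E \<omega> m u x \<le> D * (u x - u z)"
    using neg_laplacian_le_oscillation by metis
  obtain M where M: "\<And>x y. y \<le> M \<Longrightarrow> \<bar>F n f 0 x y\<bar> < 1"
    using F_small[of 1 n f] by auto
  \<comment> \<open>If the minimum is below \<open>M0\<close>, all values within \<open>K\<close> of
    it are below \<open>M\<close>, where \<open>F\<close> exceeds -1. Since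
    \<open>c \<ge> 0\<close>, the Laplacian is at most 1 there and the oscillation bound applies
    with \<open>B = 1\<close>.\<close>
  define M0 where "M0 = M - K"
  obtain P where P: "\<And>x y. lead_pos n f x \<Longrightarrow> y \<ge> P \<Longrightarrow> D * y + - (D * M0) < F n f 0 x y"
    using F_lead_pos_superlinear[of n f D "- (D * M0)"] by blast
  obtain B where B: "B \<ge> 0" "\<And>x y. \<not> lead_pos n f x \<Longrightarrow> F n f 0 x y \<le> B"
    using F_not_lead_pos_bounded_above[of n f] by blast
  define M1 where "M1 = max M (P + K * (B + \<bar>C\<bar>))"
  have "(\<forall>y. u y \<le> M1) \<and> (u z \<ge> M0 \<or> (\<forall>y. u y \<le> u z + K))"
    if c: "0 \<le> c" "c \<le> C" and u: "sol n f c u" and z: "\<And>y. u z \<le> u y" for c u z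
  proof (cases "u z \<ge> M0")
    case False
    have "laplacian E \<omega> m u y \<le> 1" if "u y \<le> u z + K * 1" for y
    proof -
      have "u y \<le> M" using that False by (simp add: M0_def)
      then show ?thesis using M[of "u y" y] neg_laplacian_eq[OF u, of y] c(1) by linarith
    qed
    then have *: "u y \<le> u z + K" for y using K[of 1 u z y] z by simp
    have "u y \<le> M1" for y using *[of y] False by (simp add: M0_def M1_def)
    then show ?thesis using * by blast
  next
    case True
    \<comment> \<open>Otherwise \<open>F\<close> would exceed the linear bound on
      \<open>- \<Delta> u\<close>, once the minimum in it is replaced by \<open>M0\<close>.\<close>
    have P_bound: "u x \<le> P" if "lead_pos n f x" for x
    proof (rule ccontr)
      assume "\<not> u x \<le> P"
      then have "D * u x + - (D * M0) < F n f 0 x (u x)" using P that by simp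
      also have "\<dots> \<le> D * (u x - u z)"
        using neg_laplacian_eq[OF u, of x] D(2)[of u z x, OF z] c(1) by linarith
      also have "\<dots> \<le> D * (u x - M0)" using D(1) True by (intro mult_left_mono) auto
      finally show False by (simp add: algebra_simps)
    qed
    obtain w where w: "\<And>y. u y \<le> u w" using obtain_max[of u] by blast
    have "u w \<le> P + K * (B + \<bar>C\<bar>)"
    proof (rule ccontr)
      assume A: "\<not> ?thesis"
      \<comment> \<open>The oscillation bound for \<open>- u\<close>: every vertex whose value is
        this close to the maximum lies above \<open>P\<close>, so its leading coefficient is not
        positive and \<open>- \<Delta> u\<close> is bounded above there. The conclusion would put
        \<open>u x0\<close> above \<open>P\<close> as well.\<close>
      have "- u x0 \<le> - u w + K * (B + \<bar>C\<bar>)"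
      proof (rule K[of "B + \<bar>C\<bar>" "\<lambda>x. - u x"])
        fix y assume "- u y \<le> - u w + K * (B + \<bar>C\<bar>)"
        then have "\<not> lead_pos n f y" using A P_bound[of y] by linarith
        then show "laplacian E \<omega> m (\<lambda>x. - u x) y \<le> B + \<bar>C\<bar>"
          using B(2)[of y "u y"] neg_laplacian_eq[OF u, of y] c by (simp add: laplacian_uminus)
      qed (use B(1) w in auto)
      then show False using A P_bound[OF assms] by linarith
    qed
    then have "u y \<le> M1" for y using w[of y] by (simp add: M1_def)
    then show ?thesis using True by blast
  qed
  then show ?thesis by blast
qed

text \<open>At a minimum \<open>F \<le> - C\<close>, which for large \<open>C\<close> forces the
  minimum above \<open>max 0 P\<close>. Then \<open>F\<close> at \<open>x0\<close> exceeds the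
  linear bound on \<open>- \<Delta> u\<close>.\<close>

lemma no_solution_large_c:
  assumes "lead_pos n f x0"
  shows "\<exists>C0. \<forall>C\<ge>C0. \<forall>u. \<not> sol n f C u"
proof -
  obtain D where D: "D \<ge> 0" "\<And>u x z. (\<And>y. u z \<le> u y) \<Longrightarrow> - laplacian E \<omega> m u x \<le> D * (u x - u z)"
    using neg_laplacian_le_oscillation by metis
  obtain P where P: "\<And>x y. lead_pos n f x \<Longrightarrow> y \<ge> P \<Longrightarrow> D * y + 0 < F n f 0 x y"
    using F_lead_pos_superlinear[of n f D 0] by blast
  obtain B where B: "B \<ge> 0" "\<And>x y. y \<le> max 0 P \<Longrightarrow> \<bar>F n f 0 x y\<bar> \<le> B"
    using F_bounded_atMost[of "max 0 P" n f] by blast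
  have False if C: "C \<ge> B + 1" and u: "sol n f C u" for C u
  proof -
    obtain z where z: "\<And>y. u z \<le> u y" using obtain_min[of u] by blast
    have uz: "u z > max 0 P"
      using B(2)[of "u z" z] solution_at_min[OF u z] C by linarith
    have "u x0 \<ge> P" using uz z[of x0] by simp
    then have "D * u x0 < F n f 0 x0 (u x0)" using P[OF assms] by simp
    also have "\<dots> \<le> D * (u x0 - u z)"
      using neg_laplacian_eq[OF u, of x0] D(2)[of u z x0, OF z] C B(1) by linarith
    also have "\<dots> \<le> D * u x0" using D(1) uz by (intro mult_left_mono) auto
    finally show False by simp
  qed
  then show ?thesis by blast
qed

section \<open>Existence and multiplicity in the two regimes\<close>

lemma solutions_lead_pos:
  assumes x0: "lead_pos n f x0" and \<psi>: "\<And>x. F n f 0 x (\<psi> x) < - laplacian E \<omega> m \<psi> x"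
  shows "\<exists>cn>0. (\<forall>c\<in>{0<..cn}. \<exists>u v. u \<noteq> v \<and> sol n f c u \<and> sol n f c v) \<and> (\<exists>u. sol n f 0 u)"
proof -
  obtain cn where cn: "cn > 0" "\<And>x. F n f 0 x (\<psi> x) + cn < - laplacian E \<omega> m \<psi> x"
    using exists_least_gap[of "\<lambda>x. F n f 0 x (\<psi> x)", OF \<psi>] by blast
  obtain C0 where C0: "\<And>C u. C \<ge> C0 \<Longrightarrow> \<not> sol n f C u"
    using no_solution_large_c[OF x0] by blast
  define C where "C = max cn C0"
  obtain M0 M1 K where bound: "\<And>c u z y. 0 \<le> c \<Longrightarrow> c \<le> C \<Longrightarrow> sol n f c u \<Longrightarrow> (\<And>y. u z \<le> u y) \<Longrightarrow> u y \<le> M1"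
    and bound': "\<And>c u z y. 0 \<le> c \<Longrightarrow> c \<le> C \<Longrightarrow> sol n f c u \<Longrightarrow> (\<And>y. u z \<le> u y) \<Longrightarrow>
      u z \<ge> M0 \<or> u y \<le> u z + K"
    using a_priori_bound_lead_pos[OF x0, of C] by metis
  obtain w where w: "\<And>y. \<psi> w \<le> \<psi> y" using obtain_min[of \<psi>] by blast
  have two: "\<exists>u v. u \<noteq> v \<and> sol n f c u \<and> sol n f c v \<and> (\<exists>x. \<psi> x < v x)" if c: "c \<in> {0<..cn}" for c
  proof -
    obtain M where M: "\<And>x y. y \<le> M \<Longrightarrow> \<bar>F n f 0 x y\<bar> < c"
      using F_small[of c n f] c by auto
    \<comment> \<open>Below \<open>M\<close> the nonlinearity is smaller than \<open>c\<close> in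
      absolute value, so the constant \<open>a\<close> is a strict subsolution. Every solution with
      parameter at least \<open>c\<close> stays above \<open>M\<close>, by the inequality at its
      minimum.\<close>
    define a where "a = min M (\<psi> w) - 1"
    have a: "a < \<psi> x" "a \<le> M" for x using w[of x] by (auto simp: a_def)
    have ge: "M < u x" if "sol n f c' u" "c \<le> c'" for c' u x
    proof -
      obtain z where z: "\<And>y. u z \<le> u y" using obtain_min[of u] by blast
      have "M < u z" using solution_at_min[OF that(1) z] M[of "u z" z] that(2) by linarith
      then show ?thesis using z[of x] by simp
    qed
    have "\<exists>u v. u \<noteq> v \<and> sol n f c u \<and> sol n f c v \<and> \<not> (\<forall>x. a \<le> v x \<and> v x \<le> \<psi> x)"
    proof (rule two_solutions[where C = C and R = "\<bar>M\<bar> + \<bar>M1\<bar>"])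
      show "a < \<psi> x" for x by (rule a)
      show "F n f 0 x (\<psi> x) + c < - laplacian E \<omega> m \<psi> x" for x using cn(2)[of x] c by simp
      show "- laplacian E \<omega> m (\<lambda>_. a) x < F n f 0 x a + c" for x
        using M[OF a(2), of x] unfolding laplacian_const by linarith
      show "\<not> sol n f C u" for u by (rule C0) (simp add: C_def)
      fix s u x assume s: "s \<in> {0..1::real}" and u: "sol n f (c + s * (C - c)) u"
      have "c \<le> C" using c by (auto simp: C_def le_max_iff_disj)
      then have c': "c \<le> c + s * (C - c)" "c + s * (C - c) \<le> C"
        using s mult_nonneg_nonneg[of s "C - c"] mult_right_mono[of s 1 "C - c"] by auto
      obtain z where z: "\<And>y. u z \<le> u y" using obtain_min[of u] by blast
      have "u x \<le> M1" using bound[OF _ c'(2) u z, of x] c'(1) c by force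
      then show "\<bar>u x\<bar> \<le> \<bar>M\<bar> + \<bar>M1\<bar>" using ge[OF u c'(1), of x] by linarith
    qed
    then obtain u v x where "u \<noteq> v" "sol n f c u" "sol n f c v" "\<not> (a \<le> v x \<and> v x \<le> \<psi> x)" by blast
    \<comment> \<open>Since \<open>a < M\<close>, the second solution can leave the box only by
      exceeding \<open>\<psi>\<close>.\<close>
    moreover have "M < v x" using ge[of c v x] \<open>sol n f c v\<close> by simp
    ultimately show ?thesis by (intro exI[of _ u] exI[of _ v]) (auto simp: a_def intro!: exI[of _ x])
  qed
  \<comment> \<open>If the minimum of \<open>v\<close> is below \<open>M0\<close>, then
    \<open>v\<close> is at most its minimum plus \<open>K\<close>; exceeding \<open>\<psi>\<close>
    somewhere forces the minimum above \<open>\<psi> w - K\<close>.\<close>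
  define L where "L = min M0 (\<psi> w - K)"
  define S :: "(real^'v) set" where "S = cbox (\<chi> x. L) (\<chi> x. M1)"
  have in_S: "(\<chi> x. v x) \<in> S" if v: "sol n f c v" "\<psi> x < v x" and c: "c \<in> {0<..cn}" for c v x
  proof -
    obtain z where z: "\<And>y. v z \<le> v y" using obtain_min[of v] by blast
    have c': "0 \<le> c" "c \<le> C" using c by (auto simp: C_def le_max_iff_disj)
    have "L \<le> v z" using bound'[OF c' v(1) z, of x] w[of x] v(2) by (auto simp: L_def)
    then have "L \<le> v y" for y using z[of y] by simp
    then show ?thesis using bound[OF c' v(1) z] by (simp add: S_def mem_box_cart)
  qed
  \<comment> \<open>The limit \<open>c\<close> to 0 is replaced by minimization: a solution for
    \<open>c\<close> has residual constantly \<open>c\<close> with respect to parameter 0, so the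
    minimum of \<open>h\<close> over the compact set \<open>S\<close> is at most every small
    multiple of \<open>CARD('v)\<close>.\<close>
  define h where "h u = (\<Sum>x\<in>UNIV. \<bar>residual n f 0 u $ x\<bar>)" for u
  have small: "\<exists>u\<in>S. h u = real CARD('v) * c" if c: "c \<in> {0<..cn}" for c
  proof -
    obtain v x where v: "sol n f c v" "\<psi> x < v x" using two[OF c] by blast
    have "residual n f 0 (\<chi> x. v x) $ y = c" for y
      using neg_laplacian_eq[OF v(1), of y] by (simp add: residual_def cong: vec_lambda_inverse)
    then have "h (\<chi> x. v x) = real CARD('v) * c" using c by (simp add: h_def)
    then show ?thesis using in_S[OF v c] by blast
  qed
  have "continuous_on S h" unfolding h_def by (intro continuous_intros)
  moreover have "compact S" by (simp add: S_def)
  moreover have "S \<noteq> {}" using small[of cn] cn(1) by auto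
  ultimately obtain u where u: "\<And>y. y \<in> S \<Longrightarrow> h u \<le> h y"
    using continuous_attains_inf[of S h] by blast
  have "h u \<le> real CARD('v) * c" if "c \<in> {0<..cn}" for c
    using small[OF that] u by metis
  moreover have "((\<lambda>c. real CARD('v) * c) \<longlongrightarrow> real CARD('v) * 0) (at_right 0)"
    by (intro tendsto_intros)
  moreover have "\<forall>\<^sub>F c in at_right 0. c \<in> {0<..cn}"
    using eventually_at_right_real[OF cn(1)] by eventually_elim auto
  ultimately have "h u \<le> real CARD('v) * 0"
    by (intro tendsto_lowerbound[where F = "at_right (0::real)"]) (auto elim: eventually_mono)
  then have "h u = 0" unfolding h_def by (simp add: sum_nonneg antisym)
  then have "residual n f 0 u = 0"
    by (simp add: h_def sum_nonneg_eq_0_iff vec_eq_iff)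
  then have zero: "\<exists>u. sol n f 0 u" by (auto simp: residual_eq_0_iff)
  have "\<forall>c\<in>{0<..cn}. \<exists>u v. u \<noteq> v \<and> sol n f c u \<and> sol n f c v"
    using two by meson
  then show ?thesis using cn(1) zero by (intro exI[of _ cn] conjI)
qed

lemma solutions_not_lead_pos:
  assumes nlp: "\<And>x. \<not> lead_pos n f x" and \<phi>: "\<And>x. - laplacian E \<omega> m \<phi> x < F n f 0 x (\<phi> x)"
  shows "\<exists>cn>0. (\<forall>c\<in>{-cn..<0}. \<exists>u v. u \<noteq> v \<and> sol n f c u \<and> sol n f c v) \<and> (\<exists>u. sol n f 0 u)"
proof -
  obtain cn where cn: "cn > 0" "\<And>x. - laplacian E \<omega> m \<phi> x + cn < F n f 0 x (\<phi> x)"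
    using exists_least_gap[of "\<lambda>x. - laplacian E \<omega> m \<phi> x", OF \<phi>] by blast
  obtain K where K0: "K \<ge> 0" and K: "\<And>u B z y. B \<ge> 0 \<Longrightarrow> (\<And>y. u z \<le> u y) \<Longrightarrow>
      (\<And>y. u y \<le> u z + K * B \<Longrightarrow> laplacian E \<omega> m u y \<le> B) \<Longrightarrow> u y \<le> u z + K * B"
    using oscillation_bound by metis
  obtain B where B: "B \<ge> 0" "\<And>x y. F n f 0 x y \<le> B"
    using F_not_lead_pos_bounded_above[of n f] nlp by blast
  obtain P where P: "\<And>x y. P \<le> y \<Longrightarrow> F n f 0 x y \<le> 0"
    using F_not_lead_pos_nonpos[of n f] nlp by blast
  obtain w where w: "\<And>y. \<phi> y \<le> \<phi> w" using obtain_max[of \<phi>] by blast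
  \<comment> \<open>From \<open>P\<close> on, \<open>F\<close> is nonpositive, so the constant
    \<open>b\<close> is a supersolution for \<open>c = 0\<close> and a strict one for
    \<open>c < 0\<close>.\<close>
  define b where "b = max P (\<phi> w + 1)"
  have b: "\<phi> x < b" "F n f 0 x b \<le> 0" for x using w[of x] P by (auto simp: b_def)
  have "\<exists>u. sol n f 0 u \<and> (\<forall>x. \<phi> x \<le> u x \<and> u x \<le> b)"
    using b less_imp_le[OF \<phi>] by (intro sub_super_solution) (auto simp: laplacian_const less_imp_le)
  then have zero: "\<exists>u. sol n f 0 u" by blast
  have two: "\<exists>u v. u \<noteq> v \<and> sol n f c u \<and> sol n f c v" if c: "c \<in> {-cn..<0}" for c
  proof -
    \<comment> \<open>With \<open>F \<le> B\<close> the equation for \<open>C\<close> fails at a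
      maximum, and \<open>C \<le> c\<close> keeps the homotopy among parameters at most
      \<open>c\<close>.\<close>
    define C where "C = min c (- (B + 1))"
    obtain M where M: "\<And>x y. y \<le> M \<Longrightarrow> \<bar>F n f 0 x y\<bar> < - c"
      using F_small[of "- c" n f] c by auto
    have "\<exists>u v. u \<noteq> v \<and> sol n f c u \<and> sol n f c v \<and> \<not> (\<forall>x. \<phi> x \<le> v x \<and> v x \<le> b)"
    proof (rule two_solutions[where C = C and R = "\<bar>P\<bar> + \<bar>M\<bar> + K * B"])
      show "\<phi> x < b" for x by (rule b)
      show "- laplacian E \<omega> m \<phi> x < F n f 0 x (\<phi> x) + c" for x using cn(2)[of x] c by simp
      show "F n f 0 x b + c < - laplacian E \<omega> m (\<lambda>_. b) x" for x
        using b(2)[of x] c by (simp add: laplacian_const)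
      show "\<not> sol n f C u" for u
      proof
        assume u: "sol n f C u"
        obtain z where z: "\<And>y. u y \<le> u z" using obtain_max[of u] by blast
        show False using solution_at_max[OF u z] B(2)[of z "u z"] by (simp add: C_def)
      qed
      fix s u x assume s: "s \<in> {0..1::real}" and u: "sol n f (c + s * (C - c)) u"
      have "s * (C - c) \<le> 0" using s by (simp add: C_def mult_nonneg_nonpos)
      then have c': "c + s * (C - c) \<le> c" by simp
      obtain z where z: "\<And>y. u y \<le> u z" using obtain_max[of u] by blast
      \<comment> \<open>At a maximum \<open>F \<ge> - c > 0\<close>, which confines the maximum
        between \<open>M\<close> and \<open>P\<close>. As \<open>- \<Delta> u \<le> B\<close>, the
        oscillation bound for \<open>- u\<close> then controls \<open>u\<close> from below.\<close>
      have F_pos: "F n f 0 z (u z) \<ge> - c" using solution_at_max[OF u z] c' by linarith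
      have uz: "u z < P" "M < u z"
        using F_pos P[of "u z" z] M[of "u z" z] c by force+
      have "- u x \<le> - u z + K * B"
      proof (rule K[of B "\<lambda>x. - u x"])
        show "laplacian E \<omega> m (\<lambda>x. - u x) y \<le> B" for y
          using B(2)[of y "u y"] neg_laplacian_eq[OF u, of y] c' c by (simp add: laplacian_uminus)
      qed (use B(1) z in auto)
      then show "\<bar>u x\<bar> \<le> \<bar>P\<bar> + \<bar>M\<bar> + K * B" using uz z[of x] mult_nonneg_nonneg[OF K0 B(1)] by linarith
    qed
    then show ?thesis by blast
  qed
  show ?thesis using cn(1) zero two by (intro exI[of _ cn] conjI ballI)
qed

section \<open>Strict sub- and supersolutions\<close>

text \<open>The shift by \<open>ln t\<close> multiplies the term of degree \<open>i\<close> by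
  \<open>t ^ i\<close>. One factor \<open>t\<close> comes out in front, and only the term of degree
  1 survives in the remaining sum as \<open>t\<close> tends to 0.\<close>

lemma F_ln_shift:
  assumes "t > 0"
  shows "F n f 0 x (ln t + t * y) = t * (\<Sum>i=1..n. f i x * (t ^ (i - 1) * exp (real i * (t * y))))"
proof -
  have "f i x * exp (real i * (ln t + t * y)) = t * (f i x * (t ^ (i - 1) * exp (real i * (t * y))))"
    if "i \<in> {1..n}" for i
  proof -
    have "exp (real i * ln t) = t ^ i" using assms by (simp add: exp_of_nat_mult)
    also have "\<dots> = t * t ^ (i - 1)" using that by (simp add: power_eq_if)
    finally show ?thesis by (simp add: distrib_left exp_add)
  qed
  then have "(\<Sum>i=1..n. f i x * exp (real i * (ln t + t * y))) =
      (\<Sum>i=1..n. t * (f i x * (t ^ (i - 1) * exp (real i * (t * y)))))"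
    by (rule sum.cong[OF refl])
  then show ?thesis by (simp add: F_def sum_distrib_left)
qed

text \<open>Both inequalities come from \<open>ln t + t v\<close> with \<open>- \<Delta> v\<close> equal to \<open>f\<^sub>1\<close> minus its average, for small
  \<open>t\<close>: to first order in \<open>t\<close> only \<open>f\<^sub>1\<close> contributes.\<close>

lemma small_perturbation:
  assumes "n \<ge> 1"
  obtains \<psi> :: "real \<Rightarrow> 'v \<Rightarrow> real" and d :: "real \<Rightarrow> 'v \<Rightarrow> real" where
    "\<And>t x. t > 0 \<Longrightarrow> - laplacian E \<omega> m (\<psi> t) x - F n f 0 x (\<psi> t x) = t * d t x"
    and "\<And>x. ((\<lambda>t. d t x) \<longlongrightarrow> - average m (f 1)) (at_right 0)"
proof -
  have "average m (\<lambda>x. f 1 x - average m (f 1)) = 0"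
    by (simp add: average_diff average_const)
  then obtain v where v: "\<And>x. - laplacian E \<omega> m v x = f 1 x - average m (f 1)"
    using poisson_solvable by blast
  define \<psi> where "\<psi> t x = ln t + t * v x" for t x
  define S where "S t x = (\<Sum>i=1..n. f i x * (t ^ (i - 1) * exp (real i * (t * v x))))" for t x
  show ?thesis
  proof (rule that[of \<psi> "\<lambda>t x. f 1 x - average m (f 1) - S t x"])
    show "- laplacian E \<omega> m (\<psi> t) x - F n f 0 x (\<psi> t x) = t * (f 1 x - average m (f 1) - S t x)"
      if "t > 0" for t x
    proof -
      have "\<psi> t = (\<lambda>x. ln t + t * v x)" by (auto simp: \<psi>_def)
      then have "- laplacian E \<omega> m (\<psi> t) x = t * (- laplacian E \<omega> m v x)"
        by (simp add: laplacian_affine)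
      moreover have "F n f 0 x (\<psi> t x) = t * S t x"
        unfolding \<psi>_def S_def by (rule F_ln_shift[OF that])
      ultimately show ?thesis unfolding v by (simp add: right_diff_distrib)
    qed
    show "((\<lambda>t. f 1 x - average m (f 1) - S t x) \<longlongrightarrow> - average m (f 1)) (at_right 0)" for x
    proof -
      have "isCont (\<lambda>t. f 1 x - average m (f 1) - S t x) 0"
        unfolding S_def by (intro continuous_intros)
      \<comment> \<open>At \<open>t = 0\<close> the power \<open>t ^ (i - 1)\<close> is 1 for
        \<open>i = 1\<close> and 0 otherwise.\<close>
      moreover have "S 0 x = (\<Sum>i=1..n. if i = 1 then f 1 x else 0)"
        unfolding S_def by (intro sum.cong) auto
      then have "S 0 x = f 1 x" using assms by simp
      ultimately show ?thesis by (simp add: isCont_def filterlim_at_split)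
    qed
  qed
qed

lemma strict_supersolution_exists:
  assumes "n \<ge> 1" and "average m (f 1) < 0"
  shows "\<exists>\<psi>. \<forall>x. F n f 0 x (\<psi> x) < - laplacian E \<omega> m \<psi> x"
proof -
  obtain \<psi> d where *: "\<And>t x. t > 0 \<Longrightarrow> - laplacian E \<omega> m (\<psi> t) x - F n f 0 x (\<psi> t x) = t * d t x"
    and lim: "\<And>x. ((\<lambda>t. d t x) \<longlongrightarrow> - average m (f 1)) (at_right 0)"
    using small_perturbation[OF assms(1), of f] by metis
  have "\<forall>\<^sub>F t in at_right 0. 0 < d t x" for x
    using lim[of x] assms(2) by (intro order_tendstoD) auto
  then have "\<forall>\<^sub>F t in at_right 0. \<forall>x. 0 < d t x" by (rule eventually_all_finite)
  moreover have "\<forall>\<^sub>F t::real in at_right 0. t > 0" by (rule eventually_at_right_less)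
  ultimately obtain t where "t > 0" "\<And>x. 0 < d t x"
    using eventually_happens'[OF trivial_limit_at_right_real eventually_conj] by (metis (no_types, lifting))
  then have "0 < - laplacian E \<omega> m (\<psi> t) x - F n f 0 x (\<psi> t x)" for x using * by simp
  then show ?thesis by (intro exI[of _ "\<psi> t"]) simp
qed

lemma strict_subsolution_exists:
  assumes "n \<ge> 1" and "average m (f 1) > 0"
  shows "\<exists>\<phi>. \<forall>x. - laplacian E \<omega> m \<phi> x < F n f 0 x (\<phi> x)"
proof -
  obtain \<psi> d where *: "\<And>t x. t > 0 \<Longrightarrow> - laplacian E \<omega> m (\<psi> t) x - F n f 0 x (\<psi> t x) = t * d t x"
    and lim: "\<And>x. ((\<lambda>t. d t x) \<longlongrightarrow> - average m (f 1)) (at_right 0)"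
    using small_perturbation[OF assms(1), of f] by metis
  have "\<forall>\<^sub>F t in at_right 0. d t x < 0" for x
    using lim[of x] assms(2) by (intro order_tendstoD) auto
  then have "\<forall>\<^sub>F t in at_right 0. \<forall>x. d t x < 0" by (rule eventually_all_finite)
  moreover have "\<forall>\<^sub>F t::real in at_right 0. t > 0" by (rule eventually_at_right_less)
  ultimately obtain t where "t > 0" "\<And>x. d t x < 0"
    using eventually_happens'[OF trivial_limit_at_right_real eventually_conj] by (metis (no_types, lifting))
  then have "- laplacian E \<omega> m (\<psi> t) x - F n f 0 x (\<psi> t x) < 0" for x using * mult_pos_neg by metis
  then show ?thesis by (intro exI[of _ "\<psi> t"]) simp
qed

section \<open>Thresholds for a single coefficient function\<close>

lemma F_split:
  assumes "i \<in> {1..n}"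
  shows "F n f 0 x y = (\<Sum>j\<in>{1..n} - {i}. others n i f j x * exp (real j * y)) + f i x * exp (real i * y)"
proof -
  have "(\<Sum>j\<in>{1..n} - {i}. others n i f j x * exp (real j * y)) = (\<Sum>j\<in>{1..n} - {i}. f j x * exp (real j * y))"
    by (intro sum.cong refl) (auto simp: others_def)
  then show ?thesis
    using assms sum.remove[of "{1..n}" i "\<lambda>j. f j x * exp (real j * y)"] by (simp add: F_def)
qed

text \<open>The threshold must serve both regimes without knowing \<open>f\<^sub>i\<close>. If the \<open>f\<^sub>j\<close> with \<open>j \<noteq> i\<close> do not
  decide which regime holds, all \<open>f\<^sub>j\<close> with \<open>j > i\<close> vanish at some \<open>z\<close>. Then a threshold that is
  positive at \<open>z\<close> excludes the second regime, and the first one is served by a \<open>\<psi>\<close> with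
  \<open>- \<Delta> \<psi>\<close> large at \<open>z\<close>.\<close>

lemma threshold_exists:
  fixes g :: "nat \<Rightarrow> 'v \<Rightarrow> real"
  assumes "i \<in> {1..n}"
  shows "\<exists>h. \<forall>f. others n i f = g \<longrightarrow> (\<exists>x. f n x \<noteq> 0) \<longrightarrow>
     ((\<exists>x. lead_pos n f x) \<longrightarrow> (\<forall>x. f i x \<le> h x) \<longrightarrow> (\<exists>\<psi>. \<forall>x. F n f 0 x (\<psi> x) < - laplacian E \<omega> m \<psi> x)) \<and>
     (i < n \<longrightarrow> (\<forall>x. \<not> lead_pos n f x) \<longrightarrow> (\<forall>x. f i x \<ge> h x) \<longrightarrow>
        (\<exists>\<phi>. \<forall>x. - laplacian E \<omega> m \<phi> x < F n f 0 x (\<phi> x)))"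
    (is "\<exists>h. \<forall>f. _ \<longrightarrow> _ \<longrightarrow> ?A f h \<and> ?B f h")
proof -
  define S where "S y x = (\<Sum>j\<in>{1..n} - {i}. g j x * exp (real j * y))" for y x
  have F_eq: "F n f 0 x y = S y x + f i x * exp (real i * y)" if "others n i f = g" for f x y
    using F_split[OF assms, of f x y] that by (simp add: S_def)
  have g_eq: "f j x = g j x" if "others n i f = g" "j \<in> {1..n}" "j \<noteq> i" for f j x
    using that by (auto simp: others_def)
  \<comment> \<open>The vertices where the leading coefficient may depend on the unknown
    \<open>f i\<close>.\<close>
  define Z where "Z = {x. \<forall>j\<in>{i<..n}. g j x = 0}"
  \<comment> \<open>The supersolution inequality for \<open>\<psi>\<close> solved for
    \<open>f i\<close>; subtracting 1 makes it strict.\<close>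
  define h where "h \<psi> x = (- laplacian E \<omega> m \<psi> x - S (\<psi> x) x) / exp (real i * \<psi> x) - 1" for \<psi> x
  have super: "F n f 0 x (\<psi> x) < - laplacian E \<omega> m \<psi> x" if f: "others n i f = g" "f i x \<le> h \<psi> x" for f \<psi> x
  proof -
    have "f i x < (- laplacian E \<omega> m \<psi> x - S (\<psi> x) x) / exp (real i * \<psi> x)"
      using f(2) by (simp add: h_def)
    then show ?thesis by (simp add: F_eq[OF f(1)] pos_less_divide_eq)
  qed
  have A: "?A f (h \<psi>)" if "others n i f = g" for f \<psi>
    using super[OF that, of _ \<psi>] by (intro impI exI[of _ \<psi>] allI) simp
  have B_vacuous: "?B f h'" if "\<exists>x. lead_pos n f x" for f h'
    using that by (intro impI) simp
  have threshold: ?thesis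
    if "\<And>f. others n i f = g \<Longrightarrow> \<exists>x. f n x \<noteq> 0 \<Longrightarrow> ?A f h'"
      and "\<And>f. others n i f = g \<Longrightarrow> \<exists>x. f n x \<noteq> 0 \<Longrightarrow> ?B f h'" for h'
  proof (rule exI[of _ h'], rule allI, rule impI, rule impI)
    fix f assume f: "others n i f = g" "\<exists>x. f n x \<noteq> 0"
    show "?A f h' \<and> ?B f h'" by (rule conjI[OF that(1)[OF f] that(2)[OF f]])
  qed
  \<comment> \<open>If \<open>Z\<close> is empty, \<open>g\<close> alone fixes the regime: the first
    two cases. Otherwise a vertex \<open>z\<close> of \<open>Z\<close> is paired with one where
    \<open>g n\<close> is nonzero; if there is none, \<open>f n\<close> would vanish identically.
    For \<open>i = n\<close> only supersolutions are required.\<close>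
  consider "i < n" "Z = {}" "\<And>f x. others n i f = g \<Longrightarrow> \<not> lead_pos n f x"
    | "i < n" "Z = {}" "\<And>f. others n i f = g \<Longrightarrow> \<exists>x. lead_pos n f x"
    | z x where "i < n" "z \<in> Z" "g n x \<noteq> 0"
    | "i < n" "\<And>x. g n x = 0"
    | "i = n"
  proof (cases "i < n \<and> Z = {}")
    case True
    \<comment> \<open>At every vertex some coefficient of degree above \<open>i\<close> is nonzero,
      so the leading degree exceeds \<open>i\<close> and its coefficient is read off from
      \<open>g\<close>.\<close>
    have lead_cong: "lead_pos n f x"
      if f: "others n i f = g" and f': "others n i f' = g" "lead_pos n f' x" for f f' x
    proof -
      obtain k where k: "k \<in> {1..n}" "f' k x > 0" "\<And>j. j \<in> {k<..n} \<Longrightarrow> f' j x = 0"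
        using f'(2) by (auto simp: lead_pos_def)
      have "\<exists>j\<in>{i<..n}. g j x \<noteq> 0" using True unfolding Z_def by blast
      then obtain j where j: "j \<in> {i<..n}" "g j x \<noteq> 0" by blast
      then have "f' j x \<noteq> 0" using g_eq[OF f'(1), of j x] assms by auto
      then have "j \<le> k" using k(3)[of j] j(1) by (meson greaterThanAtMost_iff not_le)
      then have "k > i" using j(1) by auto
      then have "f l x = f' l x" if "l \<in> {k..n}" for l
        using g_eq[OF f, of l x] g_eq[OF f'(1), of l x] that k(1) by auto
      then show ?thesis unfolding lead_pos_def using k by (intro bexI[of _ k]) auto
    qed
    show ?thesis
    proof (cases "\<exists>f x. others n i f = g \<and> lead_pos n f x")
      case ex: True
      then obtain f' x where f': "others n i f' = g" "lead_pos n f' x" by blast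
      show ?thesis
      proof (rule that(2))
        show "\<exists>x. lead_pos n f x" if "others n i f = g" for f
          using lead_cong[OF that f'] by blast
      qed (use True in auto)
    next
      case nex: False
      show ?thesis
      proof (rule that(1))
        show "\<not> lead_pos n f x" if "others n i f = g" for f x
          using nex that by blast
      qed (use True in auto)
    qed
  next
    case False
    show ?thesis
    proof (cases "i = n")
      case neq: False
      then have i: "i < n" using assms by simp
      then obtain z where z: "z \<in> Z" using False by blast
      show ?thesis
      proof (cases "\<exists>x. g n x \<noteq> 0")
        case True
        then obtain x where "g n x \<noteq> 0" by blast
        then show ?thesis by (rule that(3)[OF i z])
      next
        case False
        show ?thesis by (rule that(4)[OF i]) (use False in blast)
      qed
    qed (rule that(5))
  qed
  then show ?thesis
  proof cases
    case 1
    \<comment> \<open>The threshold makes \<open>F\<close> at least 1 at \<open>y = 0\<close>, so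
      the constant 0 is a strict subsolution.\<close>
    have "- laplacian E \<omega> m (\<lambda>_. 0) x < F n f 0 x 0" if "others n i f = g" "f i x \<ge> 1 - S 0 x" for f x
      using that by (simp add: F_eq[OF that(1)] laplacian_const)
    then have B: "?B f (\<lambda>x. 1 - S 0 x)" if "others n i f = g" for f
      using that by (intro impI exI[of _ "\<lambda>_. 0"] allI) simp
    have A: "?A f (\<lambda>x. 1 - S 0 x)" if "others n i f = g" for f
      using 1(3)[OF that] by (intro impI) simp
    show ?thesis by (rule threshold) (erule A, erule B)
  next
    case 2
    show ?thesis by (rule threshold[of "h (\<lambda>_. 0)"]) (erule A, rule B_vacuous, erule 2(3))
  next
    case (3 z x)
    have ne: "x \<noteq> z" using 3 by (auto simp: Z_def)
    \<comment> \<open>The value needed for \<open>- \<Delta> \<psi>\<close> at \<open>z\<close>: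
      with \<open>\<psi> z = 0\<close> it gives \<open>h \<psi> z = T - S 0 z - 1 = 1\<close>. The
      right-hand side \<open>r\<close> is balanced at \<open>x\<close> to have average 0.\<close>
    define T where "T = S 0 z + 2"
    define r where "r y = (if y = z then T else if y = x then - T * m z / m x else 0)" for y
    have "(\<Sum>y\<in>UNIV. m y * r y) = (\<Sum>y\<in>{z, x}. m y * r y)"
      by (rule sum.mono_neutral_right) (auto simp: r_def)
    also have "\<dots> = 0" using ne vertex_weight_pos[of x] by (simp add: r_def)
    finally have "average m r = 0" by (simp add: average_def)
    then obtain v where v: "\<And>y. - laplacian E \<omega> m v y = r y" using poisson_solvable by blast
    define \<psi> where "\<psi> = (\<lambda>y. - v z + 1 * v y)"
    have "- laplacian E \<omega> m \<psi> z = T"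
      unfolding \<psi>_def laplacian_affine using v[of z] by (simp add: r_def)
    moreover have "\<psi> z = 0" by (simp add: \<psi>_def)
    ultimately have hz: "h \<psi> z = 1" by (simp add: h_def T_def)
    have "lead_pos n f z" if f: "others n i f = g" "\<forall>y. f i y \<ge> h \<psi> y" for f
    proof -
      have "f j z = 0" if "j \<in> {i<..n}" for j
        using g_eq[OF f(1), of j z] 3(2) that assms by (auto simp: Z_def)
      moreover have "f i z > 0" using spec[OF f(2), of z] hz by linarith
      ultimately show ?thesis using assms by (auto simp: lead_pos_def)
    qed
    then have B: "?B f (h \<psi>)" if "others n i f = g" for f
      using that by (intro impI) blast
    show ?thesis by (rule threshold) (erule A, erule B)
  next
    case 4
    have "f n x = 0" if "others n i f = g" for f x
      using g_eq[OF that, of n x] 4 assms by simp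
    then show ?thesis by (intro threshold[of "h (\<lambda>_. 0)"]) auto
  next
    case 5
    then have B: "?B f (h (\<lambda>_. 0))" for f by simp
    show ?thesis by (rule threshold[of "h (\<lambda>_. 0)"]) (erule A, rule B)
  qed
qed

end

section \<open>Choice of the thresholds and distinction of the two regimes\<close>

theorem theorem1p5:
  fixes E :: "'v::finite set set" and \<omega> :: "'v \<Rightarrow> 'v \<Rightarrow> real" and m :: "'v \<Rightarrow> real" and n :: nat
  assumes "finite_connected_weighted_graph E \<omega> m"
    and "n \<ge> 1"
  shows "\<exists>fstar :: nat \<Rightarrow> (nat \<Rightarrow> 'v \<Rightarrow> real) \<Rightarrow> 'v \<Rightarrow> real.
    \<forall>f :: nat \<Rightarrow> 'v \<Rightarrow> real.
      (\<exists>x. f n x \<noteq> 0) \<and> (\<exists>i\<in>{1..n}. \<exists>x. f i x > 0) \<longrightarrow>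
      (\<exists>cn::real. cn > 0 \<and>
        (\<forall>c::real.
          (case_A m n f c \<and> average m (f 1) < 0 \<and> c \<in> {0<..cn}) \<or>
          (case_B m n f c \<and> average m (f 1) > 0 \<and> c \<in> {-cn..<0}) \<or>
          (case_A m n f c \<and> average m (f 1) \<ge> 0 \<and>
            (\<exists>i\<in>{2..n}. \<forall>x. f i x \<le> fstar i (others n i f) x) \<and> c \<in> {0..cn}) \<or>
          (case_B m n f c \<and> average m (f 1) \<le> 0 \<and>
            (\<exists>i\<in>{2..n-1}. \<forall>x. f i x \<ge> fstar i (others n i f) x) \<and> c \<in> {-cn..0})
          \<longrightarrow>
          (\<exists>u. is_solution E \<omega> m n f c u) \<and>
          ((case_A m n f c \<and> c \<in> {0<..<cn}) \<or> (case_B m n f c \<and> c \<in> {-cn<..<0}) \<longrightarrow>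
            (\<exists>u v. u \<noteq> v \<and> is_solution E \<omega> m n f c u \<and> is_solution E \<omega> m n f c v))))"
proof -
  interpret finite_connected_weighted_graph E \<omega> m by (rule assms(1))
  let ?super = "\<lambda>f. \<exists>\<psi>. \<forall>x. F n f 0 x (\<psi> x) < - laplacian E \<omega> m \<psi> x"
  let ?sub = "\<lambda>f. \<exists>\<phi>. \<forall>x. - laplacian E \<omega> m \<phi> x < F n f 0 x (\<phi> x)"
  \<comment> \<open>The property of a threshold \<open>h\<close> for the data \<open>g\<close> of
    the other functions; choosing \<open>h\<close> from \<open>i\<close> and \<open>g\<close> alone
    ensures that \<open>fstar\<close> cannot depend on \<open>f i\<close>.\<close>
  define P where "P i g h \<longleftrightarrow> (\<forall>f. others n i f = g \<longrightarrow> (\<exists>x. f n x \<noteq> 0) \<longrightarrow>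
     ((\<exists>x. lead_pos n f x) \<longrightarrow> (\<forall>x. f i x \<le> h x) \<longrightarrow> ?super f) \<and>
     (i < n \<longrightarrow> (\<forall>x. \<not> lead_pos n f x) \<longrightarrow> (\<forall>x. f i x \<ge> h x) \<longrightarrow> ?sub f))" for i g h
  define fstar where "fstar i g = (SOME h. P i g h)" for i g
  have P: "P i g (fstar i g)" if "i \<in> {1..n}" for i g
  proof -
    have "\<exists>h. P i g h" unfolding P_def by (rule threshold_exists[OF that])
    then show ?thesis unfolding fstar_def by (rule someI_ex)
  qed
  show ?thesis
  proof (intro exI[of _ fstar] allI impI, elim conjE)
    fix f :: "nat \<Rightarrow> 'v \<Rightarrow> real"
    assume fn: "\<exists>x. f n x \<noteq> 0"
    have A_iff: "case_A m n f c \<longleftrightarrow> (\<exists>x. lead_pos n f x) \<and> (c > 0 \<or> c = 0 \<and> average m (f 1) \<ge> 0)" for c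
      by (simp add: case_A_def q_infinite_iff)
    have B_iff: "case_B m n f c \<longleftrightarrow> \<not> (\<exists>x. lead_pos n f x) \<and> (c < 0 \<or> c = 0 \<and> average m (f 1) \<le> 0)" for c
      unfolding case_B_def q_infinite_iff[of n f c, symmetric] by simp
    have super_if_low: "?super f"
      if "i \<in> {2..n}" "\<forall>x. f i x \<le> fstar i (others n i f) x" "\<exists>x. lead_pos n f x" for i
      using P[of i "others n i f", unfolded P_def, rule_format, of f] that fn by simp
    have sub_if_high: "?sub f"
      if "i \<in> {2..n-1}" "\<forall>x. f i x \<ge> fstar i (others n i f) x" "\<not> (\<exists>x. lead_pos n f x)" for i
      using P[of i "others n i f", unfolded P_def, rule_format, of f] that fn by auto
    let ?two = "\<lambda>c. \<exists>u v. u \<noteq> v \<and> sol n f c u \<and> sol n f c v"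
    let ?low_A = "\<exists>i\<in>{2..n}. \<forall>x. f i x \<le> fstar i (others n i f) x"
    let ?high_B = "\<exists>i\<in>{2..n-1}. \<forall>x. f i x \<ge> fstar i (others n i f) x"
    \<comment> \<open>All four conditions reduce to one strict super- or subsolution, which yields a
      solution for \<open>c = 0\<close> and two for every other admissible \<open>c\<close>,
      endpoints included.\<close>
    have "\<exists>cn>0. \<forall>c.
       (case_A m n f c \<and> average m (f 1) < 0 \<and> c \<in> {0<..cn} \<or>
        case_B m n f c \<and> average m (f 1) > 0 \<and> c \<in> {-cn..<0} \<or>
        case_A m n f c \<and> average m (f 1) \<ge> 0 \<and> ?low_A \<and> c \<in> {0..cn} \<or>
        case_B m n f c \<and> average m (f 1) \<le> 0 \<and> ?high_B \<and> c \<in> {-cn..0}) \<longrightarrow>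
       (c = 0 \<longrightarrow> (\<exists>u. sol n f c u)) \<and> (c \<noteq> 0 \<longrightarrow> ?two c)"
    proof (cases "\<exists>x. lead_pos n f x")
      case True
      show ?thesis
      proof (cases "?super f")
        case super: True
        obtain cn where cn: "cn > 0" "\<forall>c\<in>{0<..cn}. ?two c" "\<exists>u. sol n f 0 u"
        proof -
          obtain x0 \<psi> where "lead_pos n f x0" "\<And>x. F n f 0 x (\<psi> x) < - laplacian E \<omega> m \<psi> x"
            using True super by blast
          from solutions_lead_pos[OF this] show thesis using that by blast
        qed
        then show ?thesis using True
          by (intro exI[of _ cn]) (auto simp: A_iff B_iff)
      next
        case False
        have "\<not> ?low_A" using super_if_low True False by blast
        moreover have "\<not> average m (f 1) < 0"
          using strict_supersolution_exists[OF assms(2)] False by blast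
        \<comment> \<open>Without a strict supersolution none of the four conditions can hold in
          this regime, so the value 1 for \<open>cn\<close> is arbitrary.\<close>
        ultimately show ?thesis using True by (intro exI[of _ 1]) (auto simp: B_iff)
      qed
    next
      case nlp: False
      show ?thesis
      proof (cases "?sub f")
        case sub: True
        obtain cn where cn: "cn > 0" "\<forall>c\<in>{-cn..<0}. ?two c" "\<exists>u. sol n f 0 u"
        proof -
          obtain \<phi> where \<phi>: "\<And>x. - laplacian E \<omega> m \<phi> x < F n f 0 x (\<phi> x)" using sub by blast
          have "\<And>x. \<not> lead_pos n f x" using nlp by blast
          from solutions_not_lead_pos[of n f \<phi>, OF this \<phi>] show thesis using that by blast
        qed
        then show ?thesis using nlp
          by (intro exI[of _ cn]) (auto simp: A_iff B_iff)
      next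
        case False
        have "\<not> ?high_B" using sub_if_high nlp False by blast
        moreover have "\<not> average m (f 1) > 0"
          using strict_subsolution_exists[OF assms(2)] False by blast
        ultimately show ?thesis using nlp by (intro exI[of _ 1]) (auto simp: A_iff)
      qed
    qed
    then obtain cn where "cn > 0" and cn: "\<And>c.
       (case_A m n f c \<and> average m (f 1) < 0 \<and> c \<in> {0<..cn} \<or>
        case_B m n f c \<and> average m (f 1) > 0 \<and> c \<in> {-cn..<0} \<or>
        case_A m n f c \<and> average m (f 1) \<ge> 0 \<and> ?low_A \<and> c \<in> {0..cn} \<or>
        case_B m n f c \<and> average m (f 1) \<le> 0 \<and> ?high_B \<and> c \<in> {-cn..0}) \<Longrightarrow>
       (c = 0 \<longrightarrow> (\<exists>u. sol n f c u)) \<and> (c \<noteq> 0 \<longrightarrow> ?two c)"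
      by blast
    show "\<exists>cn>0. \<forall>c.
       (case_A m n f c \<and> average m (f 1) < 0 \<and> c \<in> {0<..cn} \<or>
        case_B m n f c \<and> average m (f 1) > 0 \<and> c \<in> {-cn..<0} \<or>
        case_A m n f c \<and> average m (f 1) \<ge> 0 \<and> ?low_A \<and> c \<in> {0..cn} \<or>
        case_B m n f c \<and> average m (f 1) \<le> 0 \<and> ?high_B \<and> c \<in> {-cn..0}) \<longrightarrow>
       (\<exists>u. sol n f c u) \<and>
       (case_A m n f c \<and> c \<in> {0<..<cn} \<or> case_B m n f c \<and> c \<in> {-cn<..<0} \<longrightarrow> ?two c)"
    proof (intro exI[of _ cn] conjI allI impI)
      fix c assume "case_A m n f c \<and> average m (f 1) < 0 \<and> c \<in> {0<..cn} \<or>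
        case_B m n f c \<and> average m (f 1) > 0 \<and> c \<in> {-cn..<0} \<or>
        case_A m n f c \<and> average m (f 1) \<ge> 0 \<and> ?low_A \<and> c \<in> {0..cn} \<or>
        case_B m n f c \<and> average m (f 1) \<le> 0 \<and> ?high_B \<and> c \<in> {-cn..0}"
      note * = cn[OF this]
      show "\<exists>u. sol n f c u" using * by blast
      show "?two c" if "case_A m n f c \<and> c \<in> {0<..<cn} \<or> case_B m n f c \<and> c \<in> {-cn<..<0}"
        using * that by auto
    qed (rule \<open>cn > 0\<close>)
  qed
qed

end
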